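(* Let $\mathcal{C}$ be an $\omega$-category and $n\ge1$. For $x\in\omega Cat(I^n,\mathcal{C})$ and $1\le i\le n$, define assignments from the faces of the $(n+1)$-cube to $\mathcal{C}$ by $$\Gamma_i^-(x)(k_1\dots k_{n+1})=x(k_1\dots\max(k_i,k_{i+1})\dots k_{n+1}),\qquad \Gamma_i^+(x)(k_1\dots k_{n+1})=x(k_1\dots\min(k_i,k_{i+1})\dots k_{n+1}),$$ where $\{-,0,+\}$ is ordered by $-<0<+$. Then $\Gamma_i^-(x)$ and $\Gamma_i^+(x)$ yield $\omega$-functors from $I^{n+1}$ to $\mathcal{C}$, that is, two elements of $\omega Cat(I^{n+1},\mathcal{C})$. Moreover, in this way the cubical singular nerve of $\mathcal{C}$ is equipped with a structure of cubical set with connections.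
   Context: An $\omega$-category is a set $A$ with maps $s_n=d_n^-$ and $t_n=d_n^+$ from $A$ to $A$ ($n\ge 0$) and partial binary operations $*_n$ ($n\ge 0$), where $x*_n y$ is defined exactly when $t_n x=s_n y$, such that for all $\alpha,\beta\in\{-,+\}$: (1) $d_m^\beta d_n^\alpha x=d_m^\beta x$ if $m<n$ and $d_m^\beta d_n^\alpha x=d_n^\alpha x$ if $m\ge n$; (2) $s_nx*_nx=x*_nt_nx=x$; (3) if $x*_ny$ is defined then $s_n(x*_ny)=s_nx$, $t_n(x*_ny)=t_ny$, and $d_m^\alpha(x*_ny)=d_m^\alpha x*_nd_m^\alpha y$ for $m\neq n$; (4) $(x*_ny)*_nz=x*_n(y*_nz)$ when both sides exist; (5) $(x*_ny)*_m(z*_nw)=(x*_mz)*_n(y*_mw)$ for $m\neq n$ when both sides make sense; (6) for every $x$ there is $n$ with $s_nx=t_nx=x$; the least such $n$ is the dimension $\dim(x)$. An $\omega$-functor preserves all $s_n,t_n,*_n$; $\omega Cat$ is the resulting category. The $\omega$-category $I^n$ of the $n$-cube: let $\Lambda^n$ be the set of words $k_1\dots k_n$ in the alphabet $\{-,0,+\}$ (faces of the $n$-cube), the dimension being the number of zeros. For $x\in\Lambda^n$ of dimension $i$ and $y\in\Lambda^i$, let $r_y(x)$ be obtained by replacing the $\ell$-th zero of $x$ by $y(\ell)$ for all $\ell$. Write $b_y(x)=r_y(x)$ if $y(\ell)\ne0$ implies $y(\ell)=(-)^\ell$ (sign $-$ for $\ell$ odd, $+$ for $\ell$ even), and $e_y(x)=r_y(x)$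 if $y(\ell)\neq0$ implies $y(\ell)=(-)^{\ell+1}$. For $X\subset\Lambda^n$ let $R(X)$ be the smallest subset containing $X$ and stable under all the operations $x\mapsto b_y(x)$, $x\mapsto e_y(x)$. $I^n$ is the unique $\omega$-category whose elements are subsets of $\Lambda^n$ of the form $R(X)$, including all $R(\{x\})$, $x\in\Lambda^n$; such that every element is a composite of elements $R(\{x\})$; for $x$ of dimension $p\ge1$, $s_{p-1}R(\{x\})=R(\{b_y(x):\dim y=p-1\})$ and $t_{p-1}R(\{x\})=R(\{e_y(x):\dim y=p-1\})$; and whenever $t_pR(X)=s_pR(Y)$, $R(X)*_pR(Y)=R(X\cup Y)$. It is freely generated by the faces of the $n$-cube. For $x\in\omega Cat(I^n,\mathcal{C})$ write $x(k_1\dots k_n)=x(R(\{k_1\dots k_n\}))$. An assignment of elements of $\mathcal{C}$ to the faces of the $m$-cube "yields an $\omega$-functor" if there is a (necessarily unique) $\omega$-functor $I^m\to\mathcal{C}$ taking these values on the elements $R(\{k_1\dots k_m\})$. A cubical set consists of sets $(K_n)_{n\ge0}$, face maps $\partial_i^\alpha:K_n\to K_{n-1}$ and degeneracies $\epsilon_i:K_{n-1}\to K_n$ ($1\le i\le n$, $\alpha\in\{-,+\}$) with $\partial_i^\alpha\partial_j^\beta=\partial_{j-1}^\beta\partial_i^\alpha$ ($i<j$), $\epsilon_i\epsilon_j=\epsilon_{j+1}\epsilon_i$ ($i\le j$), $\partial_i^\alpha\epsilon_j=\epsilon_{j-1}\partial_i^\alpha$ ($i<j$), $\partial_i^\alpha\epsilon_j=\epsilon_j\partial_{i-1}^\alpha$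 ($i>j$), $\partial_i^\alpha\epsilon_i=Id$. The cubical singular nerve of $\mathcal{C}$ is the cubical set with $K_n=\omega Cat(I^n,\mathcal{C})$, $\partial_i^\alpha(x)(k_1\dots k_{n-1})=x(k_1\dots k_{i-1}\,\alpha\,k_i\dots k_{n-1})$, $\epsilon_i(x)(k_1\dots k_{n+1})=x(k_1\dots\widehat{k_i}\dots k_{n+1})$. A cubical set with connections is a cubical set with additional maps $\Gamma_i^\alpha:K_n\to K_{n+1}$ ($\alpha\in\{-,+\}$, $n\ge1$, $1\le i\le n$) satisfying: $\partial_i^\alpha\Gamma_j^\beta=\Gamma_{j-1}^\beta\partial_i^\alpha$ ($i<j$); $\partial_i^\alpha\Gamma_j^\beta=\Gamma_j^\beta\partial_{i-1}^\alpha$ ($i>j+1$); $\partial_j^\pm\Gamma_j^\pm=\partial_{j+1}^\pm\Gamma_j^\pm=Id$; $\partial_j^\pm\Gamma_j^\mp=\partial_{j+1}^\pm\Gamma_j^\mp=\epsilon_j\partial_j^\pm$; $\Gamma_i^\pm\Gamma_j^\pm=\Gamma_{j+1}^\pm\Gamma_i^\pm$ ($i\le j$); $\Gamma_i^\pm\Gamma_j^\mp=\Gamma_{j+1}^\mp\Gamma_i^\pm$ ($i<j$); $\Gamma_i^\pm\Gamma_j^\mp=\Gamma_j^\mp\Gamma_{i-1}^\pm$ ($i>j+1$); $\Gamma_i^\pm\epsilon_j=\epsilon_{j+1}\Gamma_i^\pm$ ($i<j$); $\Gamma_i^\pm\epsilon_i=\epsilon_i\epsilon_i$; $\Gamma_i^\pm\epsilon_j=\epsilon_j\Gamma_{i-1}^\pm$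 ($i>j$). *)

theory Defs
  imports "HOL-Library.FuncSet"
begin

section \<open>Omega-categories and omega-functors\<close>

datatype sign = Neg | Pos

fun flip :: "sign \<Rightarrow> sign" where
  "flip Neg = Pos"
| "flip Pos = Neg"

text \<open>
  \<open>bd C Neg n\<close> and \<open>bd C Pos n\<close> are the source \<open>s\<^sub>n\<close> and the target \<open>t\<^sub>n\<close>. The partial
  composition \<open>*\<^sub>n\<close> is the total function \<open>ocomp C n\<close>, whose values are meaningful only on
  pairs satisfying \<open>composable\<close>.
\<close>

record 'a ocat =
  cells :: "'a set"
  bd :: "sign \<Rightarrow> nat \<Rightarrow> 'a \<Rightarrow> 'a"
  ocomp :: "nat \<Rightarrow> 'a \<Rightarrow> 'a \<Rightarrow> 'a"

definition composable :: "'a ocat \<Rightarrow> nat \<Rightarrow> 'a \<Rightarrow> 'a \<Rightarrow> bool" where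
  "composable C n x y \<longleftrightarrow> x \<in> cells C \<and> y \<in> cells C \<and> bd C Pos n x = bd C Neg n y"

text \<open>
  The unit laws and \<open>bd_ocomp_other\<close> do not assert composability for the composites they mention:
  it follows from \<open>bd_bd_less\<close> and \<open>bd_bd_ge\<close>.
\<close>

locale omega_category =
  fixes C :: "'a ocat"
  assumes bd_closed: "x \<in> cells C \<Longrightarrow> bd C \<alpha> n x \<in> cells C"
    and ocomp_closed: "composable C n x y \<Longrightarrow> ocomp C n x y \<in> cells C"
    and bd_bd_less: "x \<in> cells C \<Longrightarrow> m < n \<Longrightarrow> bd C \<beta> m (bd C \<alpha> n x) = bd C \<beta> m x"
    and bd_bd_ge: "x \<in> cells C \<Longrightarrow> n \<le> m \<Longrightarrow> bd C \<beta> m (bd C \<alpha> n x) = bd C \<alpha> n x"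
    and unit_left: "x \<in> cells C \<Longrightarrow> ocomp C n (bd C Neg n x) x = x"
    and unit_right: "x \<in> cells C \<Longrightarrow> ocomp C n x (bd C Pos n x) = x"
    and source_ocomp: "composable C n x y \<Longrightarrow> bd C Neg n (ocomp C n x y) = bd C Neg n x"
    and target_ocomp: "composable C n x y \<Longrightarrow> bd C Pos n (ocomp C n x y) = bd C Pos n y"
    and bd_ocomp_other: "composable C n x y \<Longrightarrow> m \<noteq> n \<Longrightarrow>
          bd C \<alpha> m (ocomp C n x y) = ocomp C n (bd C \<alpha> m x) (bd C \<alpha> m y)"
    and ocomp_assoc: "composable C n x y \<Longrightarrow> composable C n (ocomp C n x y) z \<Longrightarrow>
          composable C n y z \<Longrightarrow> composable C n x (ocomp C n y z) \<Longrightarrow>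
          ocomp C n (ocomp C n x y) z = ocomp C n x (ocomp C n y z)"
    and interchange: "m \<noteq> n \<Longrightarrow>
          composable C n x y \<Longrightarrow> composable C n z w \<Longrightarrow>
          composable C m (ocomp C n x y) (ocomp C n z w) \<Longrightarrow>
          composable C m x z \<Longrightarrow> composable C m y w \<Longrightarrow>
          composable C n (ocomp C m x z) (ocomp C m y w) \<Longrightarrow>
          ocomp C m (ocomp C n x y) (ocomp C n z w) = ocomp C n (ocomp C m x z) (ocomp C m y w)"
    and finite_dim: "x \<in> cells C \<Longrightarrow> \<exists>n. bd C Neg n x = x \<and> bd C Pos n x = x"

text \<open>Functors are extensional functions, so that equality of functors is equality in HOL.\<close>

definition omega_functors :: "'a ocat \<Rightarrow> 'b ocat \<Rightarrow> ('a \<Rightarrow> 'b) set" where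
  "omega_functors A B = {f \<in> cells A \<rightarrow>\<^sub>E cells B.
     (\<forall>\<alpha> n. \<forall>x\<in>cells A. f (bd A \<alpha> n x) = bd B \<alpha> n (f x)) \<and>
     (\<forall>n x y. composable A n x y \<longrightarrow> f (ocomp A n x y) = ocomp B n (f x) (f y))}"

inductive_set composites :: "'a ocat \<Rightarrow> 'a set \<Rightarrow> 'a set" for C :: "'a ocat" and G :: "'a set" where
  generator: "x \<in> G \<Longrightarrow> x \<in> composites C G"
| composite: "x \<in> composites C G \<Longrightarrow> y \<in> composites C G \<Longrightarrow> composable C n x y \<Longrightarrow>
    ocomp C n x y \<in> composites C G"

section \<open>Faces of the cube\<close>

datatype letter = Minus | Zero | Plus

instantiation letter :: linorder
begin

fun rank :: "letter \<Rightarrow> nat" where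
  "rank Minus = 0"
| "rank Zero = 1"
| "rank Plus = 2"

definition less_eq_letter :: "letter \<Rightarrow> letter \<Rightarrow> bool" where
  "a \<le> b \<longleftrightarrow> rank a \<le> rank b"

definition less_letter :: "letter \<Rightarrow> letter \<Rightarrow> bool" where
  "a < b \<longleftrightarrow> rank a < rank b"

instance
proof
  fix a b :: letter
  show "a \<le> b \<Longrightarrow> b \<le> a \<Longrightarrow> a = b"
    by (cases a; cases b) (simp_all add: less_eq_letter_def)
qed (auto simp: less_eq_letter_def less_letter_def)

end

fun letter_of :: "sign \<Rightarrow> letter" where
  "letter_of Neg = Minus"
| "letter_of Pos = Plus"

type_synonym face = "letter list"

definition faces :: "nat \<Rightarrow> face set" where
  "faces n = {k. length k = n}"

definition fdim :: "face \<Rightarrow> nat" where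
  "fdim k = count_list k Zero"

text \<open>
  \<open>subst_zeros x y\<close> is \<open>r\<^sub>y(x)\<close>; it is used only for \<open>y \<in> faces (fdim x)\<close>, and the third equation
  is there for totality.
\<close>

fun subst_zeros :: "face \<Rightarrow> face \<Rightarrow> face" where
  "subst_zeros [] y = []"
| "subst_zeros (Zero # x) (c # y) = c # subst_zeros x y"
| "subst_zeros (Zero # x) [] = Zero # subst_zeros x []"
| "subst_zeros (Minus # x) y = Minus # subst_zeros x y"
| "subst_zeros (Plus # x) y = Plus # subst_zeros x y"

text \<open>\<open>(-)\<^sup>l\<close> as a letter\<close>

definition alternating :: "nat \<Rightarrow> letter" where
  "alternating l = (if odd l then Minus else Plus)"

text \<open>
  Words of type b, resp. e, are those \<open>y\<close> for which \<open>b\<^sub>y\<close>, resp. \<open>e\<^sub>y\<close>, is defined. Positions in a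
  word are counted from 1, whence \<open>y ! (l - 1)\<close>.
\<close>

definition b_type :: "face \<Rightarrow> bool" where
  "b_type y \<longleftrightarrow> (\<forall>l\<in>{1..length y}. y ! (l - 1) \<noteq> Zero \<longrightarrow> y ! (l - 1) = alternating l)"

definition e_type :: "face \<Rightarrow> bool" where
  "e_type y \<longleftrightarrow> (\<forall>l\<in>{1..length y}. y ! (l - 1) \<noteq> Zero \<longrightarrow> y ! (l - 1) = alternating (l + 1))"

inductive_set R :: "face set \<Rightarrow> face set" for X :: "face set" where
  incl: "x \<in> X \<Longrightarrow> x \<in> R X"
| b_closed: "x \<in> R X \<Longrightarrow> y \<in> faces (fdim x) \<Longrightarrow> b_type y \<Longrightarrow> subst_zeros x y \<in> R X"
| e_closed: "x \<in> R X \<Longrightarrow> y \<in> faces (fdim x) \<Longrightarrow> e_type y \<Longrightarrow> subst_zeros x y \<in> R X"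

section \<open>The omega-category of the cube\<close>

text \<open>
  These properties determine \<open>I\<close> up to the irrelevant values of \<open>bd I\<close> outside \<open>cells I\<close> and of
  \<open>ocomp I\<close> on non-composable pairs.
\<close>

locale cube_omega_category = omega_category I
  for n :: nat and I :: "face set ocat" +
  assumes cells_subset: "A \<in> cells I \<Longrightarrow> \<exists>X \<subseteq> faces n. A = R X"
    and atom_in_cells: "x \<in> faces n \<Longrightarrow> R {x} \<in> cells I"
    and cells_generated: "cells I \<subseteq> composites I ((\<lambda>x. R {x}) ` faces n)"
    and source_atom: "x \<in> faces n \<Longrightarrow> fdim x = p \<Longrightarrow> p \<ge> 1 \<Longrightarrow>
          bd I Neg (p - 1) (R {x}) =
          R {subst_zeros x y | y. y \<in> faces p \<and> b_type y \<and> fdim y = p - 1}"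
    and target_atom: "x \<in> faces n \<Longrightarrow> fdim x = p \<Longrightarrow> p \<ge> 1 \<Longrightarrow>
          bd I Pos (p - 1) (R {x}) =
          R {subst_zeros x y | y. y \<in> faces p \<and> e_type y \<and> fdim y = p - 1}"
    and ocomp_union: "X \<subseteq> faces n \<Longrightarrow> Y \<subseteq> faces n \<Longrightarrow> composable I p (R X) (R Y) \<Longrightarrow>
          ocomp I p (R X) (R Y) = R (X \<union> Y)"

section \<open>Cubical sets with connections\<close>

text \<open>
  All operations carry the dimension of their argument: \<open>face \<alpha> i n : K n \<rightarrow> K (n - 1)\<close>,
  \<open>deg i n : K n \<rightarrow> K (n + 1)\<close> and \<open>conn \<alpha> i n : K n \<rightarrow> K (n + 1)\<close>.
\<close>

locale cubical_set =
  fixes K :: "nat \<Rightarrow> 'k set"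
    and face :: "sign \<Rightarrow> nat \<Rightarrow> nat \<Rightarrow> 'k \<Rightarrow> 'k"
    and deg :: "nat \<Rightarrow> nat \<Rightarrow> 'k \<Rightarrow> 'k"
  assumes face_closed: "x \<in> K n \<Longrightarrow> 1 \<le> i \<Longrightarrow> i \<le> n \<Longrightarrow> face \<alpha> i n x \<in> K (n - 1)"
    and deg_closed: "x \<in> K n \<Longrightarrow> 1 \<le> i \<Longrightarrow> i \<le> n + 1 \<Longrightarrow> deg i n x \<in> K (n + 1)"
    and face_face: "x \<in> K n \<Longrightarrow> 1 \<le> i \<Longrightarrow> i < j \<Longrightarrow> j \<le> n \<Longrightarrow>
          face \<alpha> i (n - 1) (face \<beta> j n x) = face \<beta> (j - 1) (n - 1) (face \<alpha> i n x)"
    and deg_deg: "x \<in> K n \<Longrightarrow> 1 \<le> i \<Longrightarrow> i \<le> j \<Longrightarrow> j \<le> n + 1 \<Longrightarrow>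
          deg i (n + 1) (deg j n x) = deg (j + 1) (n + 1) (deg i n x)"
    and face_deg_less: "x \<in> K n \<Longrightarrow> 1 \<le> i \<Longrightarrow> i < j \<Longrightarrow> j \<le> n + 1 \<Longrightarrow>
          face \<alpha> i (n + 1) (deg j n x) = deg (j - 1) (n - 1) (face \<alpha> i n x)"
    and face_deg_greater: "x \<in> K n \<Longrightarrow> 1 \<le> j \<Longrightarrow> j < i \<Longrightarrow> i \<le> n + 1 \<Longrightarrow>
          face \<alpha> i (n + 1) (deg j n x) = deg j (n - 1) (face \<alpha> (i - 1) n x)"
    and face_deg_same: "x \<in> K n \<Longrightarrow> 1 \<le> i \<Longrightarrow> i \<le> n + 1 \<Longrightarrow>
          face \<alpha> i (n + 1) (deg i n x) = x"

locale cubical_set_with_connections = cubical_set K face deg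
  for K :: "nat \<Rightarrow> 'k set"
    and face :: "sign \<Rightarrow> nat \<Rightarrow> nat \<Rightarrow> 'k \<Rightarrow> 'k"
    and deg :: "nat \<Rightarrow> nat \<Rightarrow> 'k \<Rightarrow> 'k" +
  fixes conn :: "sign \<Rightarrow> nat \<Rightarrow> nat \<Rightarrow> 'k \<Rightarrow> 'k"
  assumes conn_closed: "x \<in> K n \<Longrightarrow> 1 \<le> i \<Longrightarrow> i \<le> n \<Longrightarrow> conn \<alpha> i n x \<in> K (n + 1)"
    and face_conn_less: "x \<in> K n \<Longrightarrow> 1 \<le> i \<Longrightarrow> i < j \<Longrightarrow> j \<le> n \<Longrightarrow>
          face \<alpha> i (n + 1) (conn \<beta> j n x) = conn \<beta> (j - 1) (n - 1) (face \<alpha> i n x)"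
    and face_conn_greater: "x \<in> K n \<Longrightarrow> 1 \<le> j \<Longrightarrow> j + 1 < i \<Longrightarrow> i \<le> n + 1 \<Longrightarrow>
          face \<alpha> i (n + 1) (conn \<beta> j n x) = conn \<beta> j (n - 1) (face \<alpha> (i - 1) n x)"
    and face_conn_same: "x \<in> K n \<Longrightarrow> 1 \<le> j \<Longrightarrow> j \<le> n \<Longrightarrow>
          face \<alpha> j (n + 1) (conn \<alpha> j n x) = x"
    and face_Suc_conn_same: "x \<in> K n \<Longrightarrow> 1 \<le> j \<Longrightarrow> j \<le> n \<Longrightarrow>
          face \<alpha> (j + 1) (n + 1) (conn \<alpha> j n x) = x"
    and face_conn_flip: "x \<in> K n \<Longrightarrow> 1 \<le> j \<Longrightarrow> j \<le> n \<Longrightarrow>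
          face \<alpha> j (n + 1) (conn (flip \<alpha>) j n x) = deg j (n - 1) (face \<alpha> j n x)"
    and face_Suc_conn_flip: "x \<in> K n \<Longrightarrow> 1 \<le> j \<Longrightarrow> j \<le> n \<Longrightarrow>
          face \<alpha> (j + 1) (n + 1) (conn (flip \<alpha>) j n x) = deg j (n - 1) (face \<alpha> j n x)"
    and conn_conn_same: "x \<in> K n \<Longrightarrow> 1 \<le> i \<Longrightarrow> i \<le> j \<Longrightarrow> j \<le> n \<Longrightarrow>
          conn \<alpha> i (n + 1) (conn \<alpha> j n x) = conn \<alpha> (j + 1) (n + 1) (conn \<alpha> i n x)"
    and conn_conn_flip_less: "x \<in> K n \<Longrightarrow> 1 \<le> i \<Longrightarrow> i < j \<Longrightarrow> j \<le> n \<Longrightarrow>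
          conn \<alpha> i (n + 1) (conn (flip \<alpha>) j n x) = conn (flip \<alpha>) (j + 1) (n + 1) (conn \<alpha> i n x)"
    and conn_conn_flip_greater: "x \<in> K n \<Longrightarrow> 1 \<le> j \<Longrightarrow> j + 1 < i \<Longrightarrow> i \<le> n + 1 \<Longrightarrow>
          conn \<alpha> i (n + 1) (conn (flip \<alpha>) j n x) = conn (flip \<alpha>) j (n + 1) (conn \<alpha> (i - 1) n x)"
    and conn_deg_less: "x \<in> K n \<Longrightarrow> 1 \<le> i \<Longrightarrow> i < j \<Longrightarrow> j \<le> n + 1 \<Longrightarrow>
          conn \<alpha> i (n + 1) (deg j n x) = deg (j + 1) (n + 1) (conn \<alpha> i n x)"
    and conn_deg_same: "x \<in> K n \<Longrightarrow> 1 \<le> i \<Longrightarrow> i \<le> n + 1 \<Longrightarrow>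
          conn \<alpha> i (n + 1) (deg i n x) = deg i (n + 1) (deg i n x)"
    and conn_deg_greater: "x \<in> K n \<Longrightarrow> 1 \<le> j \<Longrightarrow> j < i \<Longrightarrow> i \<le> n + 1 \<Longrightarrow>
          conn \<alpha> i (n + 1) (deg j n x) = deg j (n + 1) (conn \<alpha> (i - 1) n x)"

section \<open>The cubical singular nerve\<close>

text \<open>Throughout, \<open>I n\<close> is the omega-category of the \<open>n\<close>-cube.\<close>

definition nerve :: "(nat \<Rightarrow> face set ocat) \<Rightarrow> 'c ocat \<Rightarrow> nat \<Rightarrow> (face set \<Rightarrow> 'c) set" where
  "nerve I C n = omega_functors (I n) C"

definition has_face_values :: "nat \<Rightarrow> (face \<Rightarrow> 'c) \<Rightarrow> (face set \<Rightarrow> 'c) \<Rightarrow> bool" where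
  "has_face_values m a f \<longleftrightarrow> (\<forall>k\<in>faces m. f (R {k}) = a k)"

definition yields_functor ::
    "(nat \<Rightarrow> face set ocat) \<Rightarrow> 'c ocat \<Rightarrow> nat \<Rightarrow> (face \<Rightarrow> 'c) \<Rightarrow> bool" where
  "yields_functor I C m a \<longleftrightarrow> (\<exists>!f. f \<in> nerve I C m \<and> has_face_values m a f)"

definition yielded_functor ::
    "(nat \<Rightarrow> face set ocat) \<Rightarrow> 'c ocat \<Rightarrow> nat \<Rightarrow> (face \<Rightarrow> 'c) \<Rightarrow> (face set \<Rightarrow> 'c)" where
  "yielded_functor I C m a = (THE f. f \<in> nerve I C m \<and> has_face_values m a f)"

definition face_assign :: "sign \<Rightarrow> nat \<Rightarrow> (face set \<Rightarrow> 'c) \<Rightarrow> face \<Rightarrow> 'c" where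
  "face_assign \<alpha> i x k = x (R {take (i - 1) k @ [letter_of \<alpha>] @ drop (i - 1) k})"

definition deg_assign :: "nat \<Rightarrow> (face set \<Rightarrow> 'c) \<Rightarrow> face \<Rightarrow> 'c" where
  "deg_assign i x k = x (R {take (i - 1) k @ drop i k})"

fun merge :: "sign \<Rightarrow> letter \<Rightarrow> letter \<Rightarrow> letter" where
  "merge Neg a b = max a b"
| "merge Pos a b = min a b"

definition conn_assign :: "sign \<Rightarrow> nat \<Rightarrow> (face set \<Rightarrow> 'c) \<Rightarrow> face \<Rightarrow> 'c" where
  "conn_assign \<alpha> i x k = x (R {take (i - 1) k @ [merge \<alpha> (k ! (i - 1)) (k ! i)] @ drop (i + 1) k})"

definition nerve_face ::
    "(nat \<Rightarrow> face set ocat) \<Rightarrow> 'c ocat \<Rightarrow> sign \<Rightarrow> nat \<Rightarrow> nat \<Rightarrow> (face set \<Rightarrow> 'c) \<Rightarrow> (face set \<Rightarrow> 'c)" where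
  "nerve_face I C \<alpha> i n x = yielded_functor I C (n - 1) (face_assign \<alpha> i x)"

definition nerve_deg ::
    "(nat \<Rightarrow> face set ocat) \<Rightarrow> 'c ocat \<Rightarrow> nat \<Rightarrow> nat \<Rightarrow> (face set \<Rightarrow> 'c) \<Rightarrow> (face set \<Rightarrow> 'c)" where
  "nerve_deg I C i n x = yielded_functor I C (n + 1) (deg_assign i x)"

definition nerve_conn ::
    "(nat \<Rightarrow> face set ocat) \<Rightarrow> 'c ocat \<Rightarrow> sign \<Rightarrow> nat \<Rightarrow> nat \<Rightarrow> (face set \<Rightarrow> 'c) \<Rightarrow> (face set \<Rightarrow> 'c)" where
  "nerve_conn I C \<alpha> i n x = yielded_functor I C (n + 1) (conn_assign \<alpha> i x)"

end

theory Submission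
  imports Defs
begin

text \<open>
  No freeness of the cube is needed: each face, degeneracy and connection is induced by a map of
  faces \<open>f\<close> such that \<open>A \<mapsto> f ` A\<close> is itself an omega-functor between cubes, and the new element of
  the nerve is the composite with it. Since \<open>R X\<close> is the down-closure of \<open>X\<close> and composition of
  cells is union, compatibility with composition is automatic, and compatibility with sources and
  targets has to be checked only on the atoms \<open>R {x}\<close>. There one inducts on the dimension \<open>d\<close> of
  \<open>x\<close>: level \<open>d - 1\<close> is the defining formula, lower levels factor through it, and from level \<open>d\<close>
  on \<open>R {x}\<close> is its own source and target. The cubical identities are then identities between maps
  of faces, because a functor on a cube is determined by its values on atoms.
\<close>

section \<open>Faces and the closure operator\<close>

text \<open>\<open>Zero\<close> is the open edge and \<open>Minus\<close>, \<open>Plus\<close> its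
  ends, so \<open>face_le z x\<close> says that \<open>z\<close> is a subface of \<open>x\<close>,
  possibly \<open>x\<close> itself.\<close>

definition below :: "letter \<Rightarrow> letter \<Rightarrow> bool" where
  "below a b \<longleftrightarrow> b = Zero \<or> a = b"

abbreviation face_le :: "face \<Rightarrow> face \<Rightarrow> bool" where
  "face_le \<equiv> list_all2 below"

lemma below_simps [simp]: "below a a" "below a Zero" "below a Minus \<longleftrightarrow> a = Minus"
  "below a Plus \<longleftrightarrow> a = Plus"
  by (auto simp: below_def)

lemma face_le_refl [simp]: "face_le x x"
  by (simp add: list.rel_refl)

lemma face_le_trans: "face_le x y \<Longrightarrow> face_le y z \<Longrightarrow> face_le x z"
  by (rule list_all2_trans[of below below below]) (auto simp: below_def)

lemma face_le_length: "face_le x y \<Longrightarrow> length x = length y"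
  by (rule list_all2_lengthD)

section \<open>Dimension and substitution of zeros\<close>

lemma fdim_simps [simp]:
  "fdim [] = 0" "fdim (c # k) = (if c = Zero then Suc (fdim k) else fdim k)"
  "fdim (u @ v) = fdim u + fdim v" "fdim (replicate d Zero) = d"
  by (auto simp: fdim_def) (induction d, auto)

lemma fdim_mono: "face_le x y \<Longrightarrow> fdim x \<le> fdim y"
  by (induction rule: list_all2_induct) (auto simp: below_def)

lemma face_le_fdim_eq: "face_le x y \<Longrightarrow> fdim x = fdim y \<Longrightarrow> x = y"
proof (induction rule: list_all2_induct)
  case (Cons a x b y)
  then show ?case using fdim_mono[of x y] by (cases b) (auto split: if_splits)
qed simp

lemma subst_zeros_le: "face_le (subst_zeros x y) x"
  by (induction x y rule: subst_zeros.induct) auto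

lemma length_subst_zeros [simp]: "length (subst_zeros x y) = length x"
  using subst_zeros_le face_le_length by blast

lemma subst_zeros_replicate [simp]: "subst_zeros x (replicate (fdim x) Zero) = x"
proof (induction x)
  case (Cons a x) then show ?case by (cases a) auto
qed simp

lemma subst_zeros_append:
  "fdim u \<le> length y \<Longrightarrow>
    subst_zeros (u @ v) y = subst_zeros u (take (fdim u) y) @ subst_zeros v (drop (fdim u) y)"
proof (induction u arbitrary: y)
  case (Cons a u) then show ?case by (cases a; cases y) auto
qed simp

lemma fdim_subst_zeros: "length y = fdim x \<Longrightarrow> fdim (subst_zeros x y) = fdim y"
  by (induction x y rule: subst_zeros.induct) (auto)

lemma subst_zeros_inject:
  "length y = fdim x \<Longrightarrow> length y' = fdim x \<Longrightarrow> subst_zeros x y = subst_zeros x y' \<Longrightarrow> y = y'"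
proof (induction x arbitrary: y y')
  case (Cons a x)
  show ?case
  proof (cases "a = Zero")
    case True
    then show ?thesis using Cons by (cases y; cases y') auto
  next
    case False
    then show ?thesis using Cons by (cases a) auto
  qed
qed simp

text \<open>For \<open>d \<ge> 1\<close> these words have exactly one nonzero letter and give the
  source (\<open>Neg\<close>) or target (\<open>Pos\<close>) facets of a face of dimension
  \<open>d\<close>. For \<open>d = 0\<close> truncated subtraction leaves the empty word in both
  sets.\<close>

definition boundary_words :: "sign \<Rightarrow> nat \<Rightarrow> face set" where
  "boundary_words \<alpha> d =
     {y \<in> faces d. (case \<alpha> of Neg \<Rightarrow> b_type y | Pos \<Rightarrow> e_type y) \<and> fdim y = d - 1}"

text \<open>
  The letter allowed at the (0-based) position \<open>p\<close> of a word of type b (for \<open>Neg\<close>) or e (for \<open>Pos\<close>).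
\<close>

definition boundary_letter :: "sign \<Rightarrow> nat \<Rightarrow> letter" where
  "boundary_letter \<alpha> p = (if (\<alpha> = Neg) = even p then Minus else Plus)"

lemma boundary_word_single:
  "replicate p Zero @ boundary_letter \<alpha> p # replicate q Zero \<in> boundary_words \<alpha> (p + Suc q)"
proof -
  define c where "c = boundary_letter \<alpha> p"
  let ?y = "replicate p Zero @ c # replicate q Zero"
  have nz: "l = Suc p \<and> ?y ! (l - 1) = c" if "l \<in> {1..length ?y}" "?y ! (l - 1) \<noteq> Zero" for l
    using that by (auto simp: nth_append nth_Cons split: if_splits nat.splits)
  have "case \<alpha> of Neg \<Rightarrow> b_type ?y | Pos \<Rightarrow> e_type ?y"
  proof (cases \<alpha>)
    case Neg
    then have "c = alternating (Suc p)" by (auto simp: c_def boundary_letter_def alternating_def)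
    then show ?thesis using nz Neg unfolding b_type_def by fastforce
  next
    case Pos
    then have "c = alternating (Suc p + 1)" by (auto simp: c_def boundary_letter_def alternating_def)
    then show ?thesis using nz Pos unfolding e_type_def by fastforce
  qed
  moreover have "c \<noteq> Zero" by (auto simp: c_def boundary_letter_def)
  ultimately show ?thesis
    by (simp add: boundary_words_def faces_def flip: c_def)
qed

lemma subst_zeros_single:
  "subst_zeros (u @ Zero # v) (replicate (fdim u) Zero @ c # replicate (fdim v) Zero) = u @ c # v"
  by (simp add: subst_zeros_append)

text \<open>A word of codimension one has a nonzero letter, whose position would have to carry two
  opposite signs.\<close>

lemma boundary_words_disjoint:
  assumes "y \<in> boundary_words Neg d" "d \<ge> 1" shows "y \<notin> boundary_words Pos d"
proof
  assume "y \<in> boundary_words Pos d"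
  then have y: "length y = d" "b_type y" "e_type y" "fdim y = d - 1"
    using assms by (auto simp: boundary_words_def faces_def)
  have "\<exists>j<length y. y ! j \<noteq> Zero"
  proof (rule ccontr)
    assume "\<not> ?thesis"
    then have "y = replicate d Zero"
      using y by (auto intro!: nth_equalityI)
    then have "fdim y = d" by simp
    then show False using y assms by simp
  qed
  then obtain j where "j < length y" "y ! j \<noteq> Zero" by blast
  then have "alternating (Suc j) = alternating (Suc j + 1)"
    using y unfolding b_type_def e_type_def by (metis Suc_le_eq Suc_eq_plus1 atLeastAtMost_iff diff_Suc_1 le_add2)
  then show False by (auto simp: alternating_def split: if_splits)
qed

section \<open>The closure operator as a down-closure\<close>

lemma R_boundary_word:
  "x \<in> R X \<Longrightarrow> y \<in> boundary_words \<alpha> (fdim x) \<Longrightarrow> subst_zeros x y \<in> R X"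
  by (cases \<alpha>) (auto simp: boundary_words_def intro: R.intros)

text \<open>At any position one end of the edge is of type b and the other of type e, so every
  replacement of a single zero is one closure step.\<close>

lemma R_replace_zero: "u @ Zero # v \<in> R X \<Longrightarrow> u @ c # v \<in> R X"
proof (cases "c = Zero")
  case False
  assume *: "u @ Zero # v \<in> R X"
  obtain \<alpha> where "c = boundary_letter \<alpha> (fdim u)"
    using False by (cases c; cases "even (fdim u)") (auto simp: boundary_letter_def split: if_splits intro: that[of Neg] that[of Pos])
  then show ?thesis
    using R_boundary_word[OF *] boundary_word_single[of "fdim u" \<alpha> "fdim v"]
      subst_zeros_single[of u v c] by fastforce
qed simp

text \<open>Letters are lowered from left to right; the prefix \<open>u\<close> collects those
  already treated.\<close>

lemma R_face_le:
  assumes "face_le z x" "u @ x \<in> R X" shows "u @ z \<in> R X"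
  using assms
proof (induction arbitrary: u rule: list_all2_induct)
  case (Cons a z b x)
  have "u @ a # x \<in> R X"
    using Cons(1) Cons(4) R_replace_zero[of u x X a] by (auto simp: below_def)
  then show ?case using Cons(3)[of "u @ [a]"] by simp
qed

text \<open>The closure operations only pass to subfaces, and \<open>R_face_le\<close> reaches all
  of them.\<close>

lemma R_eq: "R X = {z. \<exists>x\<in>X. face_le z x}"
proof (intro equalityI subsetI)
  show "z \<in> {z. \<exists>x\<in>X. face_le z x}" if "z \<in> R X" for z
    using that
  proof induction
    case (incl x) then show ?case using face_le_refl by blast
  qed (use face_le_trans subst_zeros_le in blast)+
  show "z \<in> R X" if "z \<in> {z. \<exists>x\<in>X. face_le z x}" for z
    using that R_face_le[of z _ "[]" X] by (auto intro: R.incl)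
qed

lemma R_Un: "R (X \<union> Y) = R X \<union> R Y"
  by (auto simp: R_eq)

lemma R_R [simp]: "R (R X) = R X"
  by (auto simp: R_eq intro: face_le_trans)

lemma R_subset_faces: "X \<subseteq> faces n \<Longrightarrow> R X \<subseteq> faces n"
  by (auto simp: R_eq faces_def dest!: face_le_length)

section \<open>The omega-category of the cube\<close>

text \<open>For \<open>p < q\<close> taking the \<open>q\<close>-boundary does not affect the
  \<open>p\<close>-boundaries. For \<open>q < p\<close> both \<open>q\<close>-boundaries are that of
  the common \<open>p\<close>-boundary, hence equal, and this cell is fixed at level
  \<open>p\<close>.\<close>

lemma (in omega_category) composable_bd:
  assumes "composable C p x y" "q \<noteq> p"
  shows "composable C p (bd C \<alpha> q x) (bd C \<alpha> q y)"
proof (cases "p < q")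
  case True
  then show ?thesis using assms by (simp add: composable_def bd_closed bd_bd_less)
next
  case False
  then have "q < p" using assms by simp
  have cl: "x \<in> cells C" "y \<in> cells C" and e: "bd C Pos p x = bd C Neg p y"
    using assms by (auto simp: composable_def)
  have "bd C Pos p (bd C \<alpha> q x) = bd C \<alpha> q x" using bd_bd_ge cl \<open>q < p\<close> by simp
  also have "\<dots> = bd C \<alpha> q (bd C Pos p x)" using bd_bd_less cl \<open>q < p\<close> by simp
  also have "\<dots> = bd C \<alpha> q y" using bd_bd_less cl \<open>q < p\<close> e by simp
  also have "\<dots> = bd C Neg p (bd C \<alpha> q y)" using bd_bd_ge cl \<open>q < p\<close> by simp
  finally show ?thesis using cl by (simp add: composable_def bd_closed)
qed

text \<open>Composing at level \<open>m\<close> two cells fixed at that level means composing a cell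
  with itself, which is trivial by the unit law; at other levels boundaries distribute over the
  composite.\<close>

lemma (in omega_category) composites_bd_fixed:
  assumes "x \<in> composites C G" "G \<subseteq> cells C" "\<And>x \<beta>. x \<in> G \<Longrightarrow> bd C \<beta> m x = x"
  shows "x \<in> cells C \<and> (\<forall>\<beta>. bd C \<beta> m x = x)"
  using assms(1)
proof induction
  case (composite x y p)
  show ?case
  proof (cases "m = p")
    case True
    then have "x = y" using composite by (simp add: composable_def)
    then show ?thesis using composite unit_left[of x p] True by auto
  next
    case False
    then show ?thesis using composite by (simp add: ocomp_closed bd_ocomp_other)
  qed
qed (use assms in auto)

section \<open>Cells of the cube as unions of atoms\<close>

context cube_omega_category
begin

lemma cell_R: "A \<in> cells I \<Longrightarrow> R A = A"
  using cells_subset by force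

lemma cell_faces: "A \<in> cells I \<Longrightarrow> A \<subseteq> faces n"
  using cells_subset R_subset_faces by blast

lemma ocomp_eq: "composable I p A B \<Longrightarrow> ocomp I p A B = A \<union> B"
  using ocomp_union[of A B p] cell_R cell_faces
  by (auto simp: composable_def R_Un)

text \<open>The unit law \<open>bd A * A = A\<close> is a union.\<close>

lemma bd_subset:
  assumes "A \<in> cells I" shows "bd I \<alpha> p A \<subseteq> A"
proof (cases \<alpha>)
  case Neg
  have "composable I p (bd I Neg p A) A"
    using assms by (simp add: composable_def bd_closed bd_bd_ge)
  then show ?thesis using unit_left[OF assms, of p] ocomp_eq Neg by blast
next
  case Pos
  have "composable I p A (bd I Pos p A)"
    using assms by (simp add: composable_def bd_closed bd_bd_ge)
  then show ?thesis using unit_right[OF assms, of p] ocomp_eq Pos by blast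
qed

lemma bd_atom:
  assumes "x \<in> faces n" "fdim x \<ge> 1"
  shows "bd I \<alpha> (fdim x - 1) (R {x}) = R (subst_zeros x ` boundary_words \<alpha> (fdim x))"
  using source_atom[OF assms(1) refl assms(2)] target_atom[OF assms(1) refl assms(2)]
  by (cases \<alpha>) (auto simp: boundary_words_def intro!: arg_cong[of _ _ R])

text \<open>As composition is union, the factors of a composite are contained in it, so the atoms
  building \<open>A\<close> can be taken inside \<open>A\<close>. Later inductions then see only
  faces of \<open>A\<close>.\<close>

lemma cell_composite: "A \<in> cells I \<Longrightarrow> A \<in> composites I ((\<lambda>x. R {x}) ` A)"
proof -
  have mono: "B \<in> composites I H" if "B \<in> composites I G" "G \<subseteq> H" for B G H
    using that by induction (auto intro: composites.intros)
  have "A \<in> composites I ((\<lambda>x. R {x}) ` faces n) \<Longrightarrow>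
      A \<in> cells I \<and> A \<in> composites I ((\<lambda>x. R {x}) ` A)" for A
  proof (induction rule: composites.induct)
    case (generator A)
    then obtain x where "x \<in> faces n" "A = R {x}" by blast
    then show ?case
      by (auto intro!: atom_in_cells composites.generator imageI R.incl)
  next
    case (composite A B p)
    let ?G = "(\<lambda>x. R {x}) ` (A \<union> B)"
    have A: "A \<in> cells I" "A \<in> composites I ((\<lambda>x. R {x}) ` A)"
      and B: "B \<in> cells I" "B \<in> composites I ((\<lambda>x. R {x}) ` B)"
      using composite.IH by auto
    have "A \<in> composites I ?G" by (rule mono[OF A(2)]) (rule image_mono, rule Un_upper1)
    moreover have "B \<in> composites I ?G" by (rule mono[OF B(2)]) (rule image_mono, rule Un_upper2)
    ultimately have "ocomp I p A B \<in> composites I ?G"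
      using composites.composite composite.hyps by metis
    then show ?case
      using composite.hyps(3) by (simp add: ocomp_eq[symmetric] ocomp_closed)
  qed
  then show "A \<in> cells I \<Longrightarrow> A \<in> composites I ((\<lambda>x. R {x}) ` A)"
    using cells_generated by blast
qed

lemma cell_nonempty: "A \<in> cells I \<Longrightarrow> A \<noteq> {}"
proof
  assume "A \<in> cells I" "A = {}"
  then have "{} \<in> composites I {}" using cell_composite by fastforce
  moreover have "B \<notin> composites I {}" for B
  proof
    assume "B \<in> composites I {}" then show False by induction auto
  qed
  ultimately show False by blast
qed

lemma cell_atom_subset: "A \<in> cells I \<Longrightarrow> x \<in> A \<Longrightarrow> R {x} \<subseteq> A"
  using cell_R[of A] by (auto simp: R_eq)

text \<open>The defining formulas cover only level \<open>fdim x - 1\<close>. At level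
  \<open>fdim x\<close> it suffices that \<open>x\<close> still lies in the boundary, and
  \<open>bd_bd_ge\<close> carries the result to all higher levels.\<close>

lemma bd_atom_fixed:
  assumes "x \<in> faces n" "fdim x \<le> p"
  shows "bd I \<alpha> p (R {x}) = R {x}"
  using assms
proof (induction "fdim x" arbitrary: x p \<alpha> rule: less_induct)
  case less
  have cell: "R {x} \<in> cells I" using less.prems atom_in_cells by blast
  have "bd I \<alpha> (fdim x) (R {x}) = R {x}"
  proof -
    define A where "A = bd I \<alpha> (fdim x) (R {x})"
    have A: "A \<in> cells I" "A \<subseteq> R {x}"
      unfolding A_def using cell by (auto intro: bd_closed dest: bd_subset)
    have "x \<in> A"
    proof (rule ccontr)
      \<comment> \<open>Otherwise \<open>A\<close> is composed of smaller atoms, hence of dimension less than \<open>fdim x\<close>, so that the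
        source and target of \<open>R {x}\<close> at level \<open>fdim x - 1\<close> would both be \<open>A\<close>; but they differ.\<close>
      assume x: "x \<notin> A"
      have low: "fdim z < fdim x" if "z \<in> A" for z
      proof -
        have "face_le z x" using that A by (auto simp: R_eq)
        moreover have "z \<noteq> x" using that x by blast
        ultimately show ?thesis using fdim_mono face_le_fdim_eq nat_less_le by blast
      qed
      have pos: "fdim x \<ge> 1"
        using low cell_nonempty[OF A(1)] by fastforce
      have gen: "(\<lambda>x. R {x}) ` A \<subseteq> cells I"
        using cell_faces[OF A(1)] atom_in_cells by blast
      have fixed: "bd I \<beta> (fdim x - 1) B = B" if "B \<in> (\<lambda>x. R {x}) ` A" for B \<beta>
      proof -
        obtain z where z: "z \<in> A" "B = R {z}" using \<open>B \<in> _\<close> by blast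
        moreover have "z \<in> faces n" using z cell_faces[OF A(1)] by blast
        ultimately show ?thesis using less.hyps[of z "fdim x - 1" \<beta>] low[OF z(1)] by simp
      qed
      have "bd I \<beta> (fdim x - 1) A = A" for \<beta>
        using composites_bd_fixed[OF cell_composite[OF A(1)] gen fixed] by blast
      then have "bd I \<beta> (fdim x - 1) (R {x}) = A" for \<beta>
        unfolding A_def using bd_bd_less[OF cell, of "fdim x - 1" "fdim x" \<beta> \<alpha>] pos by simp
      then have eq: "R (subst_zeros x ` boundary_words Neg (fdim x)) =
          R (subst_zeros x ` boundary_words Pos (fdim x))"
        using bd_atom[OF less.prems(1) pos] by metis
      obtain q where q: "fdim x = Suc q" using pos not0_implies_Suc by fastforce
      \<comment> \<open>A source facet of \<open>x\<close> now lies below some target facet; having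
        equal dimension, the two coincide, contradicting
        \<open>boundary_words_disjoint\<close>.\<close>
      obtain y where y: "y \<in> boundary_words Neg (fdim x)"
        using boundary_word_single[of 0 Neg q] q by auto
      then have "subst_zeros x y \<in> R (subst_zeros x ` boundary_words Pos (fdim x))"
        unfolding eq[symmetric] by (auto intro: R.incl)
      then obtain y' where y': "y' \<in> boundary_words Pos (fdim x)"
          "face_le (subst_zeros x y) (subst_zeros x y')"
        by (auto simp: R_eq)
      have l: "length y = fdim x" "length y' = fdim x" "fdim y = fdim y'"
        using y y' by (auto simp: boundary_words_def faces_def)
      then have "subst_zeros x y = subst_zeros x y'"
        using y'(2) by (auto intro!: face_le_fdim_eq simp: fdim_subst_zeros)
      then have "y = y'" using l subst_zeros_inject by blast
      then show False using boundary_words_disjoint y y'(1) pos by blast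
    qed
    then show ?thesis
      using cell_atom_subset[OF A(1)] A(2) unfolding A_def by blast
  qed
  then show ?case
    using bd_bd_ge[OF cell less.prems(2), of \<alpha> \<alpha>] by simp
qed

end

section \<open>Functors induced by maps of faces\<close>

text \<open>
  The last alternative is the degenerate case: \<open>f\<close> lowers the dimension of \<open>x\<close>, and \<open>f ` R {x}\<close> is
  already the image of the source and of the target of \<open>R {x}\<close>.
\<close>

definition cubical_map :: "nat \<Rightarrow> nat \<Rightarrow> (face \<Rightarrow> face) \<Rightarrow> bool" where
  "cubical_map m n f \<longleftrightarrow> (\<forall>x\<in>faces m.
     f x \<in> faces n \<and> f ` R {x} = R {f x} \<and>
     (fdim (f x) = fdim x \<and> (\<forall>y\<in>faces (fdim x). f (subst_zeros x y) = subst_zeros (f x) y) \<or>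
      fdim (f x) < fdim x \<and> (\<forall>\<alpha>. \<exists>y\<in>boundary_words \<alpha> (fdim x). f (subst_zeros x y) = f x)))"

lemma R_image:
  assumes "cubical_map m n f" "X \<subseteq> faces m" shows "f ` R X = R (f ` X)"
proof -
  have U: "R X = (\<Union>x\<in>X. R {x})" for X by (auto simp: R_eq)
  have "f ` R X = (\<Union>x\<in>X. R {f x})"
    unfolding U[of X] image_UN using assms
    by (intro SUP_cong) (auto simp only: cubical_map_def subset_iff)
  then show ?thesis by (simp add: U[of "f ` X"])
qed

section \<open>The image map as a functor between cubes\<close>

locale cube_pair = dom: cube_omega_category m I + cod: cube_omega_category n J
  for m I n J +
  fixes f assumes f: "cubical_map m n f"
begin

definition compatible :: "face set \<Rightarrow> bool" where
  "compatible A \<longleftrightarrow> A \<in> cells I \<and> f ` A \<in> cells J \<and> (\<forall>\<alpha> p. bd J \<alpha> p (f ` A) = f ` bd I \<alpha> p A)"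

text \<open>Images commute with unions, so only boundaries matter: at level \<open>p\<close> they
  come from one factor, at other levels they are composites of the boundaries of both.\<close>

lemma compatible_ocomp:
  assumes A: "compatible A" and B: "compatible B" and c: "composable I p A B"
  shows "composable J p (f ` A) (f ` B)" "compatible (ocomp I p A B)"
proof -
  show c': "composable J p (f ` A) (f ` B)"
    using assms by (simp add: compatible_def composable_def)
  have im: "f ` ocomp I p A B = ocomp J p (f ` A) (f ` B)"
    using dom.ocomp_eq[OF c] cod.ocomp_eq[OF c'] by blast
  have "bd J \<alpha> q (f ` ocomp I p A B) = f ` bd I \<alpha> q (ocomp I p A B)" for \<alpha> q
  proof (cases "q = p")
    case True
    then show ?thesis
      unfolding im using c c' A B
      by (cases \<alpha>) (simp_all add: compatible_def dom.source_ocomp dom.target_ocomp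
          cod.source_ocomp cod.target_ocomp)
  next
    case False
    show ?thesis
      unfolding im
      using False c c' A B dom.ocomp_eq[OF dom.composable_bd[OF c False]]
        cod.ocomp_eq[OF cod.composable_bd[OF c' False]]
      by (simp add: compatible_def dom.bd_ocomp_other cod.bd_ocomp_other image_Un)
  qed
  then show "compatible (ocomp I p A B)"
    using c c' by (simp add: compatible_def im dom.ocomp_closed cod.ocomp_closed)
qed

text \<open>Requiring only the atoms of faces in \<open>A\<close> makes this usable inside the
  induction on dimension, where \<open>A\<close> is a boundary.\<close>

lemma compatible_cell:
  assumes "A \<in> cells I" "\<And>x. x \<in> A \<Longrightarrow> compatible (R {x})"
  shows "compatible A"
proof -
  have "B \<in> composites I ((\<lambda>x. R {x}) ` A) \<Longrightarrow> compatible B" for B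
    by (induction rule: composites.induct) (use assms compatible_ocomp in auto)
  then show ?thesis using dom.cell_composite[OF assms(1)] by blast
qed

text \<open>If \<open>f\<close> keeps the dimension, it carries facets to the corresponding facets.
  If it lowers the dimension, the image of \<open>R {x}\<close> is fixed at level
  \<open>fdim x - 1\<close>, and one facet already maps onto \<open>f x\<close>, so the boundary has
  the same image.\<close>

lemma image_bd_atom:
  assumes x: "x \<in> faces m" and pos: "fdim x \<ge> 1"
  shows "bd J \<alpha> (fdim x - 1) (f ` R {x}) = f ` bd I \<alpha> (fdim x - 1) (R {x})"
proof -
  let ?Y = "boundary_words \<alpha> (fdim x)"
  have fx: "f x \<in> faces n" "f ` R {x} = R {f x}"
    using f x by (auto simp: cubical_map_def)
  have sub: "subst_zeros x ` ?Y \<subseteq> faces m"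
    using x by (auto simp: faces_def)
  have bd: "f ` bd I \<alpha> (fdim x - 1) (R {x}) = R (f ` subst_zeros x ` ?Y)"
    using dom.bd_atom[OF x pos] R_image[OF f sub] by simp
  consider "fdim (f x) = fdim x" "\<forall>y\<in>faces (fdim x). f (subst_zeros x y) = subst_zeros (f x) y"
    | y where "fdim (f x) < fdim x" "y \<in> ?Y" "f (subst_zeros x y) = f x"
    using f x unfolding cubical_map_def by metis
  then show ?thesis
  proof cases
    case 1
    then have "f ` subst_zeros x ` ?Y = subst_zeros (f x) ` ?Y"
      unfolding image_image by (intro image_cong) (auto simp: boundary_words_def)
    then show ?thesis
      using cod.bd_atom[OF fx(1), of \<alpha>] 1 pos bd fx(2) by simp
  next
    case 2
    have "bd J \<alpha> (fdim x - 1) (R {f x}) = R {f x}"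
      using cod.bd_atom_fixed fx 2(1) by simp
    moreover have "R {f x} \<subseteq> R (f ` subst_zeros x ` ?Y)"
    proof -
      have "f x \<in> f ` subst_zeros x ` ?Y" using 2 by (metis imageI)
      then show ?thesis by (auto simp: R_eq)
    qed
    moreover have "f ` bd I \<alpha> (fdim x - 1) (R {x}) \<subseteq> R {f x}"
      using dom.bd_subset[OF dom.atom_in_cells[OF x]] fx(2) by blast
    ultimately show ?thesis using bd fx(2) by simp
  qed
qed

lemma compatible_atom: "x \<in> faces m \<Longrightarrow> compatible (R {x})"
proof (induction "fdim x" arbitrary: x rule: less_induct)
  case less
  have cell: "R {x} \<in> cells I" using less.prems dom.atom_in_cells by blast
  have fx: "f x \<in> faces n" "f ` R {x} = R {f x}" "fdim (f x) \<le> fdim x"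
    using f less.prems by (auto simp: cubical_map_def)
  have cell': "f ` R {x} \<in> cells J" using fx cod.atom_in_cells by simp
  have "bd J \<alpha> p (f ` R {x}) = f ` bd I \<alpha> p (R {x})" for \<alpha> p
  proof -
    consider "fdim x \<le> p" | "fdim x \<ge> 1" "p = fdim x - 1" | "fdim x \<ge> 1" "p < fdim x - 1"
      by linarith
    then show ?thesis
    proof cases
      case 1
      then show ?thesis
        using dom.bd_atom_fixed[OF less.prems] cod.bd_atom_fixed[OF fx(1)] fx by simp
    next
      case 2
      then show ?thesis using image_bd_atom[OF less.prems] by simp
    next
      case 3
      \<comment> \<open>The boundary of \<open>R {x}\<close> at the lower level \<open>p\<close> is
        one of \<open>A\<close>, whose faces have smaller dimension, so the induction hypothesis
        makes \<open>A\<close> compatible. The sign \<open>Neg\<close> is an arbitrary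
        choice.\<close>
      define A where "A = bd I Neg (fdim x - 1) (R {x})"
      have A: "A \<in> cells I" unfolding A_def using cell dom.bd_closed by blast
      have "compatible A"
      proof (rule compatible_cell[OF A])
        fix z assume z: "z \<in> A"
        then obtain y where y: "y \<in> boundary_words Neg (fdim x)" "face_le z (subst_zeros x y)"
          unfolding A_def dom.bd_atom[OF less.prems 3(1)] by (auto simp: R_eq)
        then have "fdim z \<le> fdim y"
          by (metis (mono_tags, lifting) boundary_words_def faces_def fdim_mono fdim_subst_zeros mem_Collect_eq)
        also have "\<dots> < fdim x" using y(1) 3(1) by (auto simp: boundary_words_def)
        finally show "compatible (R {z})"
          using less.hyps z dom.cell_faces[OF A] by blast
      qed
      then have "bd J \<alpha> p (f ` A) = f ` bd I \<alpha> p A" by (simp add: compatible_def)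
      then show ?thesis
        using image_bd_atom[OF less.prems 3(1), of Neg] 3(2)
          dom.bd_bd_less[OF cell 3(2), of \<alpha> Neg] cod.bd_bd_less[OF cell' 3(2), of \<alpha> Neg]
        unfolding A_def by simp
    qed
  qed
  then show ?case using cell cell' by (simp add: compatible_def)
qed

lemma compatible: "A \<in> cells I \<Longrightarrow> compatible A"
  using compatible_cell compatible_atom dom.cell_faces by blast

lemma pullback_functor:
  assumes C: "omega_category C" and x: "x \<in> omega_functors J C"
  shows "(\<lambda>A\<in>cells I. x (f ` A)) \<in> omega_functors I C"
proof -
  have bd: "f ` A \<in> cells J" "f ` bd I \<alpha> p A = bd J \<alpha> p (f ` A)" if "A \<in> cells I" for A \<alpha> p
    using compatible[OF that] by (auto simp: compatible_def)
  have comp: "composable J p (f ` A) (f ` B)" "f ` ocomp I p A B = ocomp J p (f ` A) (f ` B)"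
    if "composable I p A B" for A B p
  proof -
    show "composable J p (f ` A) (f ` B)"
      using that compatible_ocomp(1) compatible unfolding composable_def by blast
    then show "f ` ocomp I p A B = ocomp J p (f ` A) (f ` B)"
      using dom.ocomp_eq[OF that] cod.ocomp_eq by (simp add: image_Un)
  qed
  have cells: "A \<in> cells I" "B \<in> cells I" if "composable I p A B" for A B p
    using that by (auto simp: composable_def)
  have x: "x \<in> cells J \<rightarrow>\<^sub>E cells C"
    "\<And>\<alpha> p A. A \<in> cells J \<Longrightarrow> x (bd J \<alpha> p A) = bd C \<alpha> p (x A)"
    "\<And>p A B. composable J p A B \<Longrightarrow> x (ocomp J p A B) = ocomp C p (x A) (x B)"
    using x by (auto simp: omega_functors_def)
  have "x (f ` A) \<in> cells C" if "A \<in> cells I" for A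
    using x(1) bd(1)[OF that] by blast
  then show ?thesis
    unfolding omega_functors_def
    by (simp add: bd comp cells x(2,3) dom.bd_closed dom.ocomp_closed)
qed

end

section \<open>Faces, degeneracies and connections as maps of faces\<close>

text \<open>\<open>ins\<close> with a nonzero letter, \<open>del\<close> and \<open>mrg\<close>
  underlie faces, degeneracies and connections: inclusion of a facet, projection along an axis,
  folding by maximum or minimum. Positions count from 1.\<close>

definition ins :: "letter \<Rightarrow> nat \<Rightarrow> face \<Rightarrow> face" where
  "ins c i k = take (i - 1) k @ [c] @ drop (i - 1) k"

definition del :: "nat \<Rightarrow> face \<Rightarrow> face" where
  "del i k = take (i - 1) k @ drop i k"

definition mrg :: "sign \<Rightarrow> nat \<Rightarrow> face \<Rightarrow> face" where
  "mrg \<alpha> i k = take (i - 1) k @ [merge \<alpha> (k ! (i - 1)) (k ! i)] @ drop (i + 1) k"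

lemma letter_of_neq_Zero [simp]: "letter_of \<alpha> \<noteq> Zero" "Zero \<noteq> letter_of \<alpha>"
  by (cases \<alpha>; simp)+

text \<open>For \<open>merge \<alpha>\<close> the letter \<open>letter_of \<alpha>\<close> is the
  unit and the opposite end absorbs; this treats maximum and minimum at once.\<close>

lemma letter_cases:
  obtains (zero) "c = Zero" | (unit) "c = letter_of \<alpha>" | (absorbing) "c = letter_of (flip \<alpha>)"
  by (cases c; cases \<alpha>) auto

lemma merge_simps [simp]:
  "merge \<alpha> (letter_of \<alpha>) c = c" "merge \<alpha> c (letter_of \<alpha>) = c"
  "merge \<alpha> (letter_of (flip \<alpha>)) c = letter_of (flip \<alpha>)"
  "merge \<alpha> c (letter_of (flip \<alpha>)) = letter_of (flip \<alpha>)"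
  "merge (flip \<alpha>) (letter_of \<alpha>) c = letter_of \<alpha>"
  "merge (flip \<alpha>) c (letter_of \<alpha>) = letter_of \<alpha>"
  "merge \<alpha> c c = c"
  by (cases \<alpha>; cases c; simp add: max_def min_def less_eq_letter_def)+

lemma merge_assoc: "merge \<alpha> (merge \<alpha> a b) c = merge \<alpha> a (merge \<alpha> b c)"
  by (cases \<alpha>) (simp_all add: max.assoc min.assoc)

lemma merge_below: "below a a' \<Longrightarrow> below b b' \<Longrightarrow> below (merge \<alpha> a b) (merge \<alpha> a' b')"
  by (cases a'; cases b'; cases \<alpha>; cases a; cases b) (auto simp: max_def min_def less_eq_letter_def)

text \<open>Makes \<open>mrg\<close> surjective from the subfaces of \<open>x\<close> onto those of
  its image. Two zeros both become \<open>c\<close>; next to a unit the other letter becomes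
  \<open>c\<close>; if a letter absorbs, \<open>c\<close> is already the merged letter.\<close>

lemma merge_below_lift:
  assumes "below c (merge \<alpha> a b)"
  shows "\<exists>a' b'. below a' a \<and> below b' b \<and> merge \<alpha> a' b' = c"
proof (cases a rule: letter_cases[where \<alpha> = \<alpha>])
  case zero
  then show ?thesis
  proof (cases b rule: letter_cases[where \<alpha> = \<alpha>])
    case zero then show ?thesis using \<open>a = Zero\<close> by (metis below_simps(2) merge_simps(7))
  next
    case unit then show ?thesis using \<open>a = Zero\<close> by (metis below_simps(1,2) merge_simps(2))
  next
    case absorbing then show ?thesis using assms by (metis below_def letter_of_neq_Zero(1) merge_simps(4))
  qed
next
  case unit then show ?thesis using assms by (metis below_simps(1) merge_simps(1))
next
  case absorbing then show ?thesis using assms by (metis below_def letter_of_neq_Zero(1) merge_simps(3))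
qed

text \<open>
  This makes \<open>mrg \<alpha> i\<close> degenerate on a face with two adjacent zeros: in both the source and the
  target, one of these zeros can be replaced by the unit of \<open>merge \<alpha>\<close>.
\<close>

lemma boundary_letter_Suc: "boundary_letter \<beta> p = letter_of \<alpha> \<or> boundary_letter \<beta> (Suc p) = letter_of \<alpha>"
  by (cases \<alpha>) (auto simp: boundary_letter_def)

lemma boundary_subst_single:
  obtains y where "y \<in> boundary_words \<alpha> (fdim (u @ Zero # v))"
    "subst_zeros (u @ Zero # v) y = u @ boundary_letter \<alpha> (fdim u) # v"
  using boundary_word_single[of "fdim u" \<alpha> "fdim v"] subst_zeros_single[of u v] by fastforce

lemma subst_zeros_append_append:
  "length y = fdim u \<Longrightarrow> subst_zeros (u @ v) (y @ z) = subst_zeros u y @ subst_zeros v z"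
  by (simp add: subst_zeros_append)

lemma subst_zeros_Cons_nonzero: "c \<noteq> Zero \<Longrightarrow> subst_zeros (c # v) y = c # subst_zeros v y"
  by (cases c) auto

lemma faces_add_cases:
  assumes "y \<in> faces (p + q)"
  obtains y1 y2 where "y = y1 @ y2" "length y1 = p" "length y2 = q"
  using assms that[of "take p y" "drop p y"] by (auto simp: faces_def)

lemma cubical_mapI:
  assumes "\<And>x. x \<in> faces m \<Longrightarrow> f x \<in> faces n"
    and "\<And>x z. x \<in> faces m \<Longrightarrow> face_le z x \<Longrightarrow> face_le (f z) (f x)"
    and "\<And>x w. x \<in> faces m \<Longrightarrow> face_le w (f x) \<Longrightarrow> \<exists>z. face_le z x \<and> f z = w"
    and "\<And>x. x \<in> faces m \<Longrightarrow>
      fdim (f x) = fdim x \<and> (\<forall>y\<in>faces (fdim x). f (subst_zeros x y) = subst_zeros (f x) y) \<or>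
      fdim (f x) < fdim x \<and> (\<forall>\<alpha>. \<exists>y\<in>boundary_words \<alpha> (fdim x). f (subst_zeros x y) = f x)"
  shows "cubical_map m n f"
proof -
  have "f ` R {x} = R {f x}" if "x \<in> faces m" for x
    using assms(2,3)[OF that] by (fastforce simp: R_eq)
  then show ?thesis using assms(1,4) by (simp add: cubical_map_def)
qed

lemma split_list_at:
  assumes "i \<le> length k" shows "\<exists>u v. k = u @ v \<and> length u = i"
  using assms by (intro exI[of _ "take i k"] exI[of _ "drop i k"]) simp

lemma split_list_before:
  "i \<le> length k + 1 \<Longrightarrow> \<exists>u v. k = u @ v \<and> length u = i - 1"
  by (rule split_list_at) simp

lemma split_list_Cons_before:
  assumes "1 \<le> i" "i \<le> length k" shows "\<exists>u a v. k = u @ a # v \<and> length u = i - 1"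
  using assms id_take_nth_drop[of "i - 1" k]
  by (intro exI[of _ "take (i - 1) k"] exI[of _ "k ! (i - 1)"] exI[of _ "drop i k"]) simp

section \<open>The three operations as cubical maps\<close>

lemma ins_append: "length u = i - 1 \<Longrightarrow> ins c i (u @ v) = u @ c # v"
  by (simp add: ins_def)

lemma del_append: "length u = i - 1 \<Longrightarrow> 1 \<le> i \<Longrightarrow> del i (u @ a # v) = u @ v"
  by (simp add: del_def)

lemma mrg_append: "length u = i - 1 \<Longrightarrow> 1 \<le> i \<Longrightarrow> mrg \<alpha> i (u @ a # b # v) = u @ merge \<alpha> a b # v"
  by (cases i) (simp_all add: mrg_def nth_append)

text \<open>Inserting a nonzero letter keeps all zeros in order, so the first alternative of
  \<open>cubical_map\<close> always holds.\<close>

lemma cubical_map_ins: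
  assumes "1 \<le> i" "i \<le> n + 1" "c \<noteq> Zero" shows "cubical_map n (n + 1) (ins c i)"
proof (rule cubical_mapI)
  fix x assume "x \<in> faces n"
  then have n: "length x = n" by (simp add: faces_def)
  obtain u v where uv: "x = u @ v" "length u = i - 1"
    using split_list_before[of i x] assms n by blast
  then have x: "x = u @ v" "length u = i - 1" "length v = n - (i - 1)"
    using n by auto
  note f = ins_append[of _ i c]
  show "ins c i x \<in> faces (n + 1)" using x assms by (simp add: f faces_def)
  show "face_le (ins c i z) (ins c i x)" if zx: "face_le z x" for z
  proof -
    obtain u' v' where "z = u' @ v'" "face_le u' u" "face_le v' v"
      using zx x by (auto simp: list_all2_append2)
    then show ?thesis using x by (simp add: f list_all2_appendI face_le_length)
  qed
  show "\<exists>z. face_le z x \<and> ins c i z = w" if w: "face_le w (ins c i x)" for w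
  proof -
    obtain u' v' where "w = u' @ c # v'" "face_le u' u" "face_le v' v"
      using w x assms(3) by (auto simp: f list_all2_append2 list_all2_Cons2 below_def)
    then show ?thesis
      using x by (intro exI[of _ "u' @ v'"]) (simp add: f list_all2_appendI face_le_length)
  qed
  have "ins c i (subst_zeros x y) = subst_zeros (ins c i x) y" if y: "y \<in> faces (fdim x)" for y
  proof -
    have "y \<in> faces (fdim u + fdim v)" using y x by simp
    then obtain y1 y2 where "y = y1 @ y2" "length y1 = fdim u"
      using faces_add_cases by blast
    then show ?thesis
      using x assms(3) by (simp add: f subst_zeros_append_append subst_zeros_Cons_nonzero)
  qed
  then show "fdim (ins c i x) = fdim x \<and>
        (\<forall>y\<in>faces (fdim x). ins c i (subst_zeros x y) = subst_zeros (ins c i x) y) \<or>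
      fdim (ins c i x) < fdim x \<and>
        (\<forall>\<alpha>. \<exists>y\<in>boundary_words \<alpha> (fdim x). ins c i (subst_zeros x y) = ins c i x)"
    using x assms(3) by (simp add: f)
qed

text \<open>Deleting a nonzero letter keeps all zeros. Deleting a zero collapses an axis, and a
  facet across that axis, of either sign, has the same image as \<open>x\<close>.\<close>

lemma cubical_map_del:
  assumes "1 \<le> i" "i \<le> n + 1" shows "cubical_map (n + 1) n (del i)"
proof (rule cubical_mapI)
  fix x assume "x \<in> faces (n + 1)"
  then have n: "length x = n + 1" by (simp add: faces_def)
  then obtain u a v where uv: "x = u @ a # v" "length u = i - 1"
    using split_list_Cons_before[of i x] assms by auto
  then have x: "x = u @ a # v" "length u = i - 1" "length v = n - (i - 1)"
    using n by auto
  note f = del_append[OF _ assms(1)]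
  show "del i x \<in> faces n" using x assms by (simp add: f faces_def)
  show "face_le (del i z) (del i x)" if zx: "face_le z x" for z
  proof -
    obtain u' a' v' where "z = u' @ a' # v'" "face_le u' u" "face_le v' v"
      using zx x by (auto simp: list_all2_append2 list_all2_Cons2)
    then show ?thesis using x by (simp add: f list_all2_appendI face_le_length)
  qed
  show "\<exists>z. face_le z x \<and> del i z = w" if w: "face_le w (del i x)" for w
  proof -
    obtain u' v' where "w = u' @ v'" "face_le u' u" "face_le v' v"
      using w x by (auto simp: f list_all2_append2)
    then show ?thesis
      using x by (intro exI[of _ "u' @ a # v'"]) (simp add: f list_all2_appendI face_le_length)
  qed
  show "fdim (del i x) = fdim x \<and>
        (\<forall>y\<in>faces (fdim x). del i (subst_zeros x y) = subst_zeros (del i x) y) \<or>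
      fdim (del i x) < fdim x \<and>
        (\<forall>\<alpha>. \<exists>y\<in>boundary_words \<alpha> (fdim x). del i (subst_zeros x y) = del i x)"
  proof (cases "a = Zero")
    case True
    have "\<exists>y\<in>boundary_words \<alpha> (fdim x). del i (subst_zeros x y) = del i x" for \<alpha>
      using boundary_subst_single[of \<alpha> u v] x f unfolding True by metis
    then show ?thesis using x True by (simp add: f)
  next
    case False
    have "del i (subst_zeros x y) = subst_zeros (del i x) y" if y: "y \<in> faces (fdim x)" for y
    proof -
      have "y \<in> faces (fdim u + fdim v)" using y x False by simp
      then obtain y1 y2 where "y = y1 @ y2" "length y1 = fdim u"
        using faces_add_cases by blast
      then show ?thesis
        using x False by (simp add: f subst_zeros_append_append subst_zeros_Cons_nonzero)
    qed
    then show ?thesis using x False by (simp add: f)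
  qed
qed

text \<open>The dimension is kept if one of the merged letters is the unit or both are nonzero. Two
  zeros, or a zero beside the absorbing letter, lose one dimension.\<close>

lemma cubical_map_mrg:
  assumes "1 \<le> i" "i \<le> n" shows "cubical_map (n + 1) n (mrg \<alpha> i)"
proof (rule cubical_mapI)
  fix x assume "x \<in> faces (n + 1)"
  then have n: "length x = n + 1" by (simp add: faces_def)
  then obtain u a v' where uv: "x = u @ a # v'" "length u = i - 1"
    using split_list_Cons_before[of i x] assms by auto
  then have "length v' = Suc (n - i)" using assms n by simp
  then obtain b v where "v' = b # v" "length v = n - i"
    by (auto simp: length_Suc_conv)
  then have x: "x = u @ a # b # v" "length u = i - 1" "length v = n - i"
    using uv by auto
  note f = mrg_append[OF _ assms(1), of _ \<alpha>]
  show "mrg \<alpha> i x \<in> faces n" using x assms by (simp add: f faces_def)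
  show "face_le (mrg \<alpha> i z) (mrg \<alpha> i x)" if zx: "face_le z x" for z
  proof -
    obtain u' a' b' v' where
      "z = u' @ a' # b' # v'" "face_le u' u" "below a' a" "below b' b" "face_le v' v"
      using zx x by (auto simp: list_all2_append2 list_all2_Cons2)
    then show ?thesis using x by (simp add: f list_all2_appendI face_le_length merge_below)
  qed
  show "\<exists>z. face_le z x \<and> mrg \<alpha> i z = w" if w: "face_le w (mrg \<alpha> i x)" for w
  proof -
    obtain u' c v' where *: "w = u' @ c # v'" "face_le u' u" "below c (merge \<alpha> a b)" "face_le v' v"
      using w x by (auto simp: f list_all2_append2 list_all2_Cons2)
    then obtain a' b' where "below a' a" "below b' b" "merge \<alpha> a' b' = c"
      using merge_below_lift by blast
    then show ?thesis
      using x * by (intro exI[of _ "u' @ a' # b' # v'"]) (simp add: f list_all2_appendI face_le_length)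
  qed
  \<comment> \<open>The required facet replaces \<open>a\<close> or \<open>b\<close>, if it is zero,
    by the one letter that the sign \<open>\<beta>\<close> permits at its position among the zeros;
    only the merged letter has to stay the same.\<close>
  have word: "\<exists>y\<in>boundary_words \<beta> (fdim x). mrg \<alpha> i (subst_zeros x y) = mrg \<alpha> i x"
    if "a = Zero \<and> merge \<alpha> (boundary_letter \<beta> (fdim u)) b = merge \<alpha> a b \<or>
        b = Zero \<and> merge \<alpha> a (boundary_letter \<beta> (fdim (u @ [a]))) = merge \<alpha> a b" for \<beta>
    using that
  proof (elim disjE conjE)
    assume *: "a = Zero" "merge \<alpha> (boundary_letter \<beta> (fdim u)) b = merge \<alpha> a b"
    obtain y where "y \<in> boundary_words \<beta> (fdim (u @ Zero # b # v))"
        "subst_zeros (u @ Zero # b # v) y = u @ boundary_letter \<beta> (fdim u) # b # v"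
      using boundary_subst_single .
    then show ?thesis using * x f by metis
  next
    assume *: "b = Zero" "merge \<alpha> a (boundary_letter \<beta> (fdim (u @ [a]))) = merge \<alpha> a b"
    obtain y where "y \<in> boundary_words \<beta> (fdim ((u @ [a]) @ Zero # v))"
        "subst_zeros ((u @ [a]) @ Zero # v) y = (u @ [a]) @ boundary_letter \<beta> (fdim (u @ [a])) # v"
      using boundary_subst_single .
    then show ?thesis using * x f by (intro bexI[of _ y]) simp_all
  qed
  show "fdim (mrg \<alpha> i x) = fdim x \<and>
        (\<forall>y\<in>faces (fdim x). mrg \<alpha> i (subst_zeros x y) = subst_zeros (mrg \<alpha> i x) y) \<or>
      fdim (mrg \<alpha> i x) < fdim x \<and>
        (\<forall>\<beta>. \<exists>y\<in>boundary_words \<beta> (fdim x). mrg \<alpha> i (subst_zeros x y) = mrg \<alpha> i x)"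
    (is "?same \<or> ?drop")
  proof -
    have same: ?same if ab: "a \<noteq> Zero \<and> merge \<alpha> a b \<noteq> Zero \<and> b \<noteq> Zero \<or> a = letter_of \<alpha> \<or> b = letter_of \<alpha>"
    proof -
      have d: "fdim (mrg \<alpha> i x) = fdim x"
        using ab x by (auto simp: f)
      have "mrg \<alpha> i (subst_zeros x y) = subst_zeros (mrg \<alpha> i x) y" if y: "y \<in> faces (fdim x)" for y
      proof -
        have "y \<in> faces (fdim u + fdim (a # b # v))" using y x by simp
        then obtain y1 y2 where y12: "y = y1 @ y2" "length y1 = fdim u" "length y2 = fdim (a # b # v)"
          using faces_add_cases by blast
        consider "a \<noteq> Zero" "merge \<alpha> a b \<noteq> Zero" "b \<noteq> Zero" | "a = letter_of \<alpha>" "b = Zero"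
          | "b = letter_of \<alpha>" "a = Zero"
          using ab by fastforce
        then show ?thesis
        proof cases
          case 1
          then show ?thesis
            using x y12 by (simp add: f subst_zeros_append_append subst_zeros_Cons_nonzero)
        next
          case 2
          then obtain c y3 where "y2 = c # y3" using y12 by (cases y2) auto
          then show ?thesis
            using x y12 2 by (simp add: f subst_zeros_append_append subst_zeros_Cons_nonzero)
        next
          case 3
          then obtain c y3 where "y2 = c # y3" using y12 by (cases y2) auto
          then show ?thesis
            using x y12 3 by (simp add: f subst_zeros_append_append subst_zeros_Cons_nonzero)
        qed
      qed
      then show ?thesis using d by blast
    qed
    consider "a = letter_of \<alpha> \<or> b = letter_of \<alpha>" | "a = Zero" "b = Zero"
      | "a = Zero" "b = letter_of (flip \<alpha>)" | "a = letter_of (flip \<alpha>)" "b = Zero"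
      | "a = letter_of (flip \<alpha>)" "b = letter_of (flip \<alpha>)"
      using letter_cases[where c = a and \<alpha> = \<alpha>] letter_cases[where c = b and \<alpha> = \<alpha>] by metis
    then show ?thesis
    proof cases
      case 1
      then show ?thesis using same by blast
    next
      case 2
      then have "\<exists>y\<in>boundary_words \<beta> (fdim x). mrg \<alpha> i (subst_zeros x y) = mrg \<alpha> i x" for \<beta>
        using boundary_letter_Suc[of \<beta> "fdim u" \<alpha>] by (intro word) auto
      then show ?thesis using x 2 by (simp add: f)
    next
      case 3
      \<comment> \<open>The absorbing letter determines the merged one, so the zero may become
        whichever letter \<open>\<beta>\<close> permits.\<close>
      then have "\<exists>y\<in>boundary_words \<beta> (fdim x). mrg \<alpha> i (subst_zeros x y) = mrg \<alpha> i x" for \<beta>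
        by (intro word) auto
      then show ?thesis using x 3 by (simp add: f)
    next
      case 4
      then have "\<exists>y\<in>boundary_words \<beta> (fdim x). mrg \<alpha> i (subst_zeros x y) = mrg \<alpha> i x" for \<beta>
        by (intro word) auto
      then show ?thesis using x 4 by (simp add: f)
    next
      case 5
      then show ?thesis using same by simp
    qed
  qed
qed

section \<open>Commutation of the operations on words\<close>

lemma length_ops [simp]:
  "length (ins c i k) = length k + 1"
  "1 \<le> i \<Longrightarrow> i \<le> length k \<Longrightarrow> length (del i k) = length k - 1"
  "1 \<le> i \<Longrightarrow> i < length k \<Longrightarrow> length (mrg \<alpha> i k) = length k - 1"
  by (simp_all add: ins_def del_def mrg_def)

text \<open>An operation acting inside one part of a split word ignores the other.
  \<open>mrg\<close> reads positions \<open>i\<close> and \<open>i + 1\<close>, whence its strict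
  bound in the prefix.\<close>

lemma local_ops:
  "i \<le> length u + 1 \<Longrightarrow> ins c i (u @ v) = ins c i u @ v"
  "length u < i \<Longrightarrow> ins c i (u @ v) = u @ ins c (i - length u) v"
  "i \<le> length u \<Longrightarrow> del i (u @ v) = del i u @ v"
  "length u < i \<Longrightarrow> del i (u @ v) = u @ del (i - length u) v"
  "1 \<le> i \<Longrightarrow> i < length u \<Longrightarrow> mrg \<alpha> i (u @ v) = mrg \<alpha> i u @ v"
  "length u < i \<Longrightarrow> mrg \<alpha> i (u @ v) = u @ mrg \<alpha> (i - length u) v"
  by (auto simp: ins_def del_def mrg_def nth_append Suc_diff_le)

text \<open>The word is cut so that the operations act in different parts. Here and in the next
  identities the prefix belongs to the operation further left, with length \<open>i - 1\<close> for
  an insertion at \<open>i\<close>, \<open>i\<close> for a deletion and \<open>i + 1\<close> for a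
  merging.\<close>

lemma ins_ins:
  assumes "1 \<le> i" "i < j" "j \<le> length k + 2"
  shows "ins c j (ins d i k) = ins d i (ins c (j - 1) k)"
proof -
  obtain u v where "k = u @ v" "length u = i - 1"
    using assms split_list_before[of i k] by auto
  then show ?thesis using assms by (simp add: local_ops)
qed

lemma del_del:
  assumes "1 \<le> i" "i \<le> j" "j + 1 \<le> length k"
  shows "del j (del i k) = del i (del (j + 1) k)"
proof -
  obtain u v where "k = u @ v" "length u = i"
    using assms split_list_at[of "i" k] by auto
  then show ?thesis using assms by (simp add: local_ops)
qed

lemma del_ins_less:
  assumes "1 \<le> i" "i < j" "j \<le> length k + 1"
  shows "del j (ins c i k) = ins c i (del (j - 1) k)"
proof -
  obtain u v where "k = u @ v" "length u = i - 1"
    using assms split_list_before[of i k] by auto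
  then show ?thesis using assms by (simp add: local_ops)
qed

lemma del_ins_greater:
  assumes "1 \<le> j" "j < i" "i \<le> length k + 1"
  shows "del j (ins c i k) = ins c (i - 1) (del j k)"
proof -
  obtain u v where "k = u @ v" "length u = j"
    using assms split_list_at[of "j" k] by auto
  then show ?thesis using assms by (simp add: local_ops)
qed

lemma mrg_ins_less:
  assumes "1 \<le> i" "i < j" "j \<le> length k"
  shows "mrg \<alpha> j (ins c i k) = ins c i (mrg \<alpha> (j - 1) k)"
proof -
  obtain u v where "k = u @ v" "length u = i - 1"
    using assms split_list_before[of i k] by auto
  then show ?thesis using assms by (simp add: local_ops)
qed

lemma mrg_ins_greater:
  assumes "1 \<le> j" "j + 1 < i" "i \<le> length k + 1"
  shows "mrg \<alpha> j (ins c i k) = ins c (i - 1) (mrg \<alpha> j k)"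
proof -
  obtain u v where "k = u @ v" "length u = j + 1"
    using assms split_list_at[of "j + 1" k] by auto
  then show ?thesis using assms by (simp add: local_ops)
qed

lemma mrg_mrg_less:
  assumes "1 \<le> i" "i < j" "j + 1 < length k"
  shows "mrg \<beta> j (mrg \<alpha> i k) = mrg \<alpha> i (mrg \<beta> (j + 1) k)"
proof -
  obtain u v where "k = u @ v" "length u = i + 1"
    using assms split_list_at[of "i + 1" k] by auto
  then show ?thesis using assms by (simp add: local_ops)
qed

lemma del_mrg_less:
  assumes "1 \<le> i" "i < j" "j < length k"
  shows "del j (mrg \<alpha> i k) = mrg \<alpha> i (del (j + 1) k)"
proof -
  obtain u v where "k = u @ v" "length u = i + 1"
    using assms split_list_at[of "i + 1" k] by auto
  then show ?thesis using assms by (simp add: local_ops)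
qed

lemma del_mrg_greater:
  assumes "1 \<le> j" "j < i" "i < length k"
  shows "del j (mrg \<alpha> i k) = mrg \<alpha> (i - 1) (del j k)"
proof -
  obtain u v where "k = u @ v" "length u = j"
    using assms split_list_at[of "j" k] by auto
  then show ?thesis using assms by (simp add: local_ops)
qed

lemma del_ins_same:
  assumes "1 \<le> i" "i \<le> length k + 1"
  shows "del i (ins c i k) = k"
proof -
  obtain u v where "k = u @ v" "length u = i - 1"
    using assms split_list_before[of i k] by auto
  then show ?thesis using assms by (simp add: ins_append del_append)
qed

lemma ins_Suc_append: "length u = i - 1 \<Longrightarrow> 1 \<le> i \<Longrightarrow> ins c (i + 1) (u @ b # v) = u @ b # c # v"
  by (simp add: ins_def)

lemma mrg_ins_unit:
  assumes "1 \<le> j" "j \<le> length k" "i = j \<or> i = j + 1"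
  shows "mrg \<alpha> j (ins (letter_of \<alpha>) i k) = k"
proof -
  obtain u b v where "k = u @ b # v" "length u = j - 1"
    using assms split_list_Cons_before[of j k] by auto
  then show ?thesis using assms
    by (elim disjE) (simp_all only: ins_append ins_Suc_append mrg_append merge_simps)
qed

text \<open>\<open>letter_of \<alpha>\<close> absorbs for the opposite merge: it swallows the letter
  at \<open>j\<close> and stands in its place.\<close>

lemma mrg_ins_absorbing:
  assumes "1 \<le> j" "j \<le> length k" "i = j \<or> i = j + 1"
  shows "mrg (flip \<alpha>) j (ins (letter_of \<alpha>) i k) = ins (letter_of \<alpha>) j (del j k)"
proof -
  obtain u b v where "k = u @ b # v" "length u = j - 1"
    using assms split_list_Cons_before[of j k] by auto
  then show ?thesis using assms
    by (elim disjE) (simp_all only: ins_append ins_Suc_append del_append mrg_append merge_simps)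
qed

text \<open>For \<open>i = j\<close> three adjacent letters are merged, which is associativity;
  otherwise two disjoint pairs are merged.\<close>

lemma mrg_mrg_same:
  assumes "1 \<le> i" "i \<le> j" "j + 1 < length k"
  shows "mrg \<alpha> j (mrg \<alpha> i k) = mrg \<alpha> i (mrg \<alpha> (j + 1) k)"
proof (cases "i = j")
  case True
  obtain u a v' where "k = u @ a # v'" "length u = i - 1"
    using assms split_list_Cons_before[of i k] by auto
  moreover then obtain b c v where "v' = b # c # v"
    using assms True by (cases v'; cases "tl v'") auto
  ultimately show ?thesis
    using assms True mrg_append[of "u @ [a]" "i + 1" \<alpha> b c v]
    by (simp add: mrg_append merge_assoc)
qed (use assms mrg_mrg_less in auto)

lemma del_mrg_same:
  assumes "1 \<le> i" "i < length k"
  shows "del i (mrg \<alpha> i k) = del i (del i k)"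
proof -
  obtain u a v' where "k = u @ a # v'" "length u = i - 1"
    using assms split_list_Cons_before[of i k] by auto
  moreover then obtain b v where "v' = b # v"
    using assms by (cases v') auto
  ultimately show ?thesis using assms by (simp add: mrg_append del_append)
qed

section \<open>The nerve\<close>

locale cubical_nerve = omega_category C for C :: "'c ocat" +
  fixes I :: "nat \<Rightarrow> face set ocat"
  assumes cube: "cube_omega_category n (I n)"
begin

definition pullback :: "nat \<Rightarrow> (face \<Rightarrow> face) \<Rightarrow> (face set \<Rightarrow> 'c) \<Rightarrow> (face set \<Rightarrow> 'c)" where
  "pullback m f x = (\<lambda>A\<in>cells (I m). x (f ` A))"

lemma cube_pair: "cubical_map m n f \<Longrightarrow> cube_pair m (I m) n (I n) f"
  by (simp add: cube_pair_def cube_pair_axioms_def cube)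

lemma pullback_nerve:
  "cubical_map m n f \<Longrightarrow> x \<in> nerve I C n \<Longrightarrow> pullback m f x \<in> nerve I C m"
  unfolding nerve_def pullback_def
  using cube_pair.pullback_functor[OF cube_pair] omega_category_axioms by blast

lemma pullback_atom:
  assumes "cubical_map m n f" "k \<in> faces m" shows "pullback m f x (R {k}) = x (R {f k})"
  using assms cube_omega_category.atom_in_cells[OF cube] by (simp add: pullback_def cubical_map_def)

lemma nerve_eqI:
  assumes x: "x \<in> nerve I C n" and y: "y \<in> nerve I C n"
    and eq: "\<And>k. k \<in> faces n \<Longrightarrow> x (R {k}) = y (R {k})"
  shows "x = y"
proof (rule extensionalityI[of _ "cells (I n)"])
  show "x \<in> extensional (cells (I n))" "y \<in> extensional (cells (I n))"
    using x y by (auto simp: nerve_def omega_functors_def PiE_def)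
  have "A \<in> composites (I n) ((\<lambda>x. R {x}) ` faces n) \<Longrightarrow> x A = y A" for A
    by (induction rule: composites.induct)
      (use eq x y in \<open>auto simp: nerve_def omega_functors_def\<close>)
  then show "x A = y A" if "A \<in> cells (I n)" for A
    using that cube_omega_category.cells_generated[OF cube] by blast
qed

text \<open>The pullback is a candidate and \<open>nerve_eqI\<close> makes it the only one, so the
  definite description in \<open>yielded_functor\<close> can be evaluated.\<close>

lemma yields_pullback:
  assumes "cubical_map m n f" "x \<in> nerve I C n" "\<And>k. k \<in> faces m \<Longrightarrow> a k = x (R {f k})"
  shows "yields_functor I C m a" "yielded_functor I C m a = pullback m f x"
proof -
  have *: "pullback m f x \<in> nerve I C m \<and> has_face_values m a (pullback m f x)"
    using assms by (simp add: pullback_nerve has_face_values_def pullback_atom)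
  have "g = pullback m f x" if "g \<in> nerve I C m \<and> has_face_values m a g" for g
    using that * by (intro nerve_eqI) (auto simp: has_face_values_def)
  then show "yields_functor I C m a" "yielded_functor I C m a = pullback m f x"
    unfolding yields_functor_def yielded_functor_def using *
    by (intro ex1I[of _ "pullback m f x"] the_equality; blast)+
qed

definition acts_by ::
    "((face set \<Rightarrow> 'c) \<Rightarrow> (face set \<Rightarrow> 'c)) \<Rightarrow> nat \<Rightarrow> nat \<Rightarrow> (face \<Rightarrow> face) \<Rightarrow> bool" where
  "acts_by F m n f \<longleftrightarrow> cubical_map m n f \<and> (\<forall>x\<in>nerve I C n. F x = pullback m f x)"

lemma acts_by_closed: "acts_by F m n f \<Longrightarrow> x \<in> nerve I C n \<Longrightarrow> F x \<in> nerve I C m"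
  by (metis acts_by_def pullback_nerve)

lemma acts_by_atom:
  "acts_by F m n f \<Longrightarrow> x \<in> nerve I C n \<Longrightarrow> k \<in> faces m \<Longrightarrow> F x (R {k}) = x (R {f k})"
  by (metis acts_by_def pullback_atom)

lemma acts_by_faces: "acts_by F m n f \<Longrightarrow> k \<in> faces m \<Longrightarrow> f k \<in> faces n"
  by (simp add: acts_by_def cubical_map_def)

text \<open>Pullback reverses composition: on the atom of \<open>k\<close>, \<open>F (G x)\<close>
  is the value of \<open>x\<close> at the atom of \<open>g (f k)\<close>. The dimensions
  \<open>m\<close> and \<open>m'\<close> may differ, as for a face of a degeneracy.\<close>

lemma acts_by_commute:
  assumes F: "acts_by F l m f" and G: "acts_by G m n g"
    and F': "acts_by F' l m' f'" and G': "acts_by G' m' n g'"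
    and x: "x \<in> nerve I C n" and eq: "\<And>k. k \<in> faces l \<Longrightarrow> g (f k) = g' (f' k)"
  shows "F (G x) = F' (G' x)"
proof (rule nerve_eqI)
  show "F (G x) \<in> nerve I C l" "F' (G' x) \<in> nerve I C l"
    using assms acts_by_closed by blast+
  show "F (G x) (R {k}) = F' (G' x) (R {k})" if "k \<in> faces l" for k
    using that acts_by_atom[OF F acts_by_closed[OF G x]] acts_by_atom[OF G x] acts_by_faces[OF F]
      acts_by_atom[OF F' acts_by_closed[OF G' x]] acts_by_atom[OF G' x] acts_by_faces[OF F'] eq
    by simp
qed

lemma acts_by_inverse:
  assumes F: "acts_by F n m f" and G: "acts_by G m n g"
    and x: "x \<in> nerve I C n" and eq: "\<And>k. k \<in> faces n \<Longrightarrow> g (f k) = k"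
  shows "F (G x) = x"
proof (rule nerve_eqI[OF _ x])
  show "F (G x) \<in> nerve I C n"
    using assms acts_by_closed by blast
  show "F (G x) (R {k}) = x (R {k})" if "k \<in> faces n" for k
    using that acts_by_atom[OF F acts_by_closed[OF G x]] acts_by_atom[OF G x] acts_by_faces[OF F] eq
    by simp
qed

text \<open>\<open>m\<close> is a variable bound by an equation, so that dimensions such as
  \<open>n + 1 - 1\<close> unify when operations are chained, the arithmetic being left as side
  conditions.\<close>

lemma acts_by_face:
  assumes "1 \<le> i" "i \<le> n" "m = n - 1"
  shows "acts_by (nerve_face I C \<alpha> i n) m n (ins (letter_of \<alpha>) i)"
proof -
  have "cubical_map m n (ins (letter_of \<alpha>) i)"
    using assms cubical_map_ins[of i m "letter_of \<alpha>"] by simp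
  then show ?thesis
    using yields_pullback(2)[of m n "ins (letter_of \<alpha>) i" _ "face_assign \<alpha> i _"]
    by (simp add: acts_by_def nerve_face_def assms(3) face_assign_def ins_def)
qed

lemma acts_by_deg:
  assumes "1 \<le> i" "i \<le> n + 1" "m = n + 1"
  shows "acts_by (nerve_deg I C i n) m n (del i)"
  using cubical_map_del[OF assms(1,2)] yields_pullback(2)[of m n "del i" _ "deg_assign i _"]
  by (simp add: acts_by_def nerve_deg_def assms(3) deg_assign_def del_def)

lemma yields_conn:
  assumes "1 \<le> i" "i \<le> n" "x \<in> nerve I C n"
  shows "yields_functor I C (n + 1) (conn_assign \<alpha> i x)"
    "yielded_functor I C (n + 1) (conn_assign \<alpha> i x) = pullback (n + 1) (mrg \<alpha> i) x"
  using yields_pullback[OF cubical_map_mrg[OF assms(1,2)] assms(3)]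
  by (simp_all add: conn_assign_def mrg_def)

lemma acts_by_conn:
  assumes "1 \<le> i" "i \<le> n" "m = n + 1"
  shows "acts_by (nerve_conn I C \<alpha> i n) m n (mrg \<alpha> i)"
  unfolding acts_by_def nerve_conn_def assms(3)
  using cubical_map_mrg[OF assms(1,2)] yields_conn(2)[OF assms(1,2)] by blast

lemma cubical_set: "cubical_set (nerve I C) (nerve_face I C) (nerve_deg I C)"
proof
  fix x n i j and \<alpha> \<beta> :: sign
  assume x: "x \<in> nerve I C n"
  show "nerve_face I C \<alpha> i n x \<in> nerve I C (n - 1)" if "1 \<le> i" "i \<le> n"
    by (rule acts_by_closed[OF acts_by_face x]) (use that in simp_all)
  show "nerve_deg I C i n x \<in> nerve I C (n + 1)" if "1 \<le> i" "i \<le> n + 1"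
    by (rule acts_by_closed[OF acts_by_deg x]) (use that in simp_all)
  show "nerve_face I C \<alpha> i (n - 1) (nerve_face I C \<beta> j n x) =
      nerve_face I C \<beta> (j - 1) (n - 1) (nerve_face I C \<alpha> i n x)"
    if "1 \<le> i" "i < j" "j \<le> n"
    by (rule acts_by_commute[OF acts_by_face acts_by_face acts_by_face acts_by_face x])
      (use that in \<open>simp add: faces_def ins_ins\<close>)+
  show "nerve_deg I C i (n + 1) (nerve_deg I C j n x) =
      nerve_deg I C (j + 1) (n + 1) (nerve_deg I C i n x)"
    if "1 \<le> i" "i \<le> j" "j \<le> n + 1"
    by (rule acts_by_commute[OF acts_by_deg acts_by_deg acts_by_deg acts_by_deg x])
      (use that in \<open>simp add: faces_def del_del\<close>)+
  show "nerve_face I C \<alpha> i (n + 1) (nerve_deg I C j n x) =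
      nerve_deg I C (j - 1) (n - 1) (nerve_face I C \<alpha> i n x)"
    if "1 \<le> i" "i < j" "j \<le> n + 1"
    by (rule acts_by_commute[OF acts_by_face acts_by_deg acts_by_deg acts_by_face x])
      (use that in \<open>simp add: faces_def del_ins_less\<close>)+
  show "nerve_face I C \<alpha> i (n + 1) (nerve_deg I C j n x) =
      nerve_deg I C j (n - 1) (nerve_face I C \<alpha> (i - 1) n x)"
    if "1 \<le> j" "j < i" "i \<le> n + 1"
    by (rule acts_by_commute[OF acts_by_face acts_by_deg acts_by_deg acts_by_face x])
      (use that in \<open>simp add: faces_def del_ins_greater\<close>)+
  show "nerve_face I C \<alpha> i (n + 1) (nerve_deg I C i n x) = x"
    if "1 \<le> i" "i \<le> n + 1"
    by (rule acts_by_inverse[OF acts_by_face acts_by_deg x])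
      (use that in \<open>simp add: faces_def del_ins_same\<close>)+
qed

lemma cubical_set_with_connections:
  "cubical_set_with_connections (nerve I C) (nerve_face I C) (nerve_deg I C) (nerve_conn I C)"
proof (intro cubical_set_with_connections.intro cubical_set cubical_set_with_connections_axioms.intro)
  fix x n i j and \<alpha> \<beta> :: sign
  assume x: "x \<in> nerve I C n"
  show "nerve_conn I C \<alpha> i n x \<in> nerve I C (n + 1)" if "1 \<le> i" "i \<le> n"
    by (rule acts_by_closed[OF acts_by_conn x]) (use that in simp_all)
  show "nerve_face I C \<alpha> i (n + 1) (nerve_conn I C \<beta> j n x) =
      nerve_conn I C \<beta> (j - 1) (n - 1) (nerve_face I C \<alpha> i n x)"
    if "1 \<le> i" "i < j" "j \<le> n"
    by (rule acts_by_commute[OF acts_by_face acts_by_conn acts_by_conn acts_by_face x])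
      (use that in \<open>simp add: faces_def mrg_ins_less\<close>)+
  show "nerve_face I C \<alpha> i (n + 1) (nerve_conn I C \<beta> j n x) =
      nerve_conn I C \<beta> j (n - 1) (nerve_face I C \<alpha> (i - 1) n x)"
    if "1 \<le> j" "j + 1 < i" "i \<le> n + 1"
    by (rule acts_by_commute[OF acts_by_face acts_by_conn acts_by_conn acts_by_face x])
      (use that in \<open>simp add: faces_def mrg_ins_greater\<close>)+
  show "nerve_face I C \<alpha> j (n + 1) (nerve_conn I C \<alpha> j n x) = x"
    if "1 \<le> j" "j \<le> n"
    by (rule acts_by_inverse[OF acts_by_face acts_by_conn x])
      (use that in \<open>simp add: faces_def mrg_ins_unit\<close>)+
  show "nerve_face I C \<alpha> (j + 1) (n + 1) (nerve_conn I C \<alpha> j n x) = x"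
    if "1 \<le> j" "j \<le> n"
    by (rule acts_by_inverse[OF acts_by_face acts_by_conn x])
      (use that in \<open>simp add: faces_def mrg_ins_unit\<close>)+
  show "nerve_face I C \<alpha> j (n + 1) (nerve_conn I C (flip \<alpha>) j n x) =
      nerve_deg I C j (n - 1) (nerve_face I C \<alpha> j n x)"
    if "1 \<le> j" "j \<le> n"
    by (rule acts_by_commute[OF acts_by_face acts_by_conn acts_by_deg acts_by_face x])
      (use that in \<open>simp add: faces_def mrg_ins_absorbing\<close>)+
  show "nerve_face I C \<alpha> (j + 1) (n + 1) (nerve_conn I C (flip \<alpha>) j n x) =
      nerve_deg I C j (n - 1) (nerve_face I C \<alpha> j n x)"
    if "1 \<le> j" "j \<le> n"
    by (rule acts_by_commute[OF acts_by_face acts_by_conn acts_by_deg acts_by_face x])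
      (use that in \<open>simp add: faces_def mrg_ins_absorbing\<close>)+
  show "nerve_conn I C \<alpha> i (n + 1) (nerve_conn I C \<alpha> j n x) =
      nerve_conn I C \<alpha> (j + 1) (n + 1) (nerve_conn I C \<alpha> i n x)"
    if "1 \<le> i" "i \<le> j" "j \<le> n"
    by (rule acts_by_commute[OF acts_by_conn acts_by_conn acts_by_conn acts_by_conn x])
      (use that in \<open>simp add: faces_def mrg_mrg_same\<close>)+
  show "nerve_conn I C \<alpha> i (n + 1) (nerve_conn I C (flip \<alpha>) j n x) =
      nerve_conn I C (flip \<alpha>) (j + 1) (n + 1) (nerve_conn I C \<alpha> i n x)"
    if "1 \<le> i" "i < j" "j \<le> n"
    by (rule acts_by_commute[OF acts_by_conn acts_by_conn acts_by_conn acts_by_conn x])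
      (use that in \<open>simp add: faces_def mrg_mrg_less\<close>)+
  \<comment> \<open>\<open>mrg_mrg_less\<close> is used at the positions \<open>j\<close> and
    \<open>i - 1\<close>. Overlapping merges are excluded here, since a maximum and a minimum do not
    associate.\<close>
  show "nerve_conn I C \<alpha> i (n + 1) (nerve_conn I C (flip \<alpha>) j n x) =
      nerve_conn I C (flip \<alpha>) j (n + 1) (nerve_conn I C \<alpha> (i - 1) n x)"
    if "1 \<le> j" "j + 1 < i" "i \<le> n + 1"
    by (rule acts_by_commute[OF acts_by_conn acts_by_conn acts_by_conn acts_by_conn x])
      (use that in \<open>simp add: faces_def mrg_mrg_less\<close>)+
  show "nerve_conn I C \<alpha> i (n + 1) (nerve_deg I C j n x) =
      nerve_deg I C (j + 1) (n + 1) (nerve_conn I C \<alpha> i n x)"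
    if "1 \<le> i" "i < j" "j \<le> n + 1"
    by (rule acts_by_commute[OF acts_by_conn acts_by_deg acts_by_deg acts_by_conn x])
      (use that in \<open>simp add: faces_def del_mrg_less\<close>)+
  show "nerve_conn I C \<alpha> i (n + 1) (nerve_deg I C i n x) =
      nerve_deg I C i (n + 1) (nerve_deg I C i n x)"
    if "1 \<le> i" "i \<le> n + 1"
    by (rule acts_by_commute[OF acts_by_conn acts_by_deg acts_by_deg acts_by_deg x])
      (use that in \<open>simp add: faces_def del_mrg_same\<close>)+
  show "nerve_conn I C \<alpha> i (n + 1) (nerve_deg I C j n x) =
      nerve_deg I C j (n + 1) (nerve_conn I C \<alpha> (i - 1) n x)"
    if "1 \<le> j" "j < i" "i \<le> n + 1"
    by (rule acts_by_commute[OF acts_by_conn acts_by_deg acts_by_deg acts_by_conn x])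
      (use that in \<open>simp add: faces_def del_mrg_greater\<close>)+
qed

end

theorem theorem6p1:
  fixes C :: "'c ocat" and I :: "nat \<Rightarrow> face set ocat"
  assumes "omega_category C"
    and "\<And>n. cube_omega_category n (I n)"
  shows "(\<forall>n\<ge>1. \<forall>x\<in>nerve I C n. \<forall>i\<in>{1..n}.
            yields_functor I C (n + 1) (conn_assign Neg i x) \<and>
            yields_functor I C (n + 1) (conn_assign Pos i x)) \<and>
         cubical_set_with_connections
           (nerve I C) (nerve_face I C) (nerve_deg I C) (nerve_conn I C)"
proof -
  interpret cubical_nerve C I
    by (intro cubical_nerve.intro cubical_nerve_axioms.intro assms)
  show ?thesis
    using yields_conn(1) cubical_set_with_connections by auto
qed

end
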